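(* Let $d \geq 2$ and let $\{W_{t_1,\dots,t_d} : (t_1,\dots,t_d)\in[0,1]^d\}$ be the Brownian sheet, realized so that every sample path belongs to $C_0([0,1]^d)$. Then, almost surely, the sample path $(t_1,\dots,t_d)\mapsto W_{t_1,\dots,t_d}$ is not strongly chargeable.
   Context: The Brownian sheet is a centered Gaussian process indexed by $[0,1]^d$ with covariance $\mathbb{E}(W_{t_1,\dots,t_d}W_{t'_1,\dots,t'_d})=\prod_{i=1}^d\min(t_i,t'_i)$; it admits a continuous modification, and one takes all its sample paths to be in $C_0([0,1]^d)$, the space of continuous real functions on $[0,1]^d$ that vanish at every point having at least one zero coordinate. Increments: for $f\in C_0([0,1]^d)$ and a rectangle $K=\prod_{i=1}^d[a_i,b_i]\subseteq[0,1]^d$ (with $a_i<b_i$), $\Delta_f(K)=\sum_{(c_i)\in\prod_i\{a_i,b_i\}}(-1)^{\#\{i:\,c_i=a_i\}}f(c_1,\dots,c_d)$. A figure is a finite union of rectangles contained in $[0,1]^d$; $\Delta_f$ extends uniquely to a function on figures that is additive on almost disjoint figures (i.e. figures whose intersection is Lebesgue negligible). $BV([0,1]^d)$ is the space of $u\in BV(\mathbb{R}^d)$ that vanish a.e. outside $[0,1]^d$, with norm $\|u\|_{BV}=\|u\|_1+\|Du\|(\mathbb{R}^d)$, where $\|Du\|$ is the total variation measure of the distributional gradient $Du$. For $f\in L^d([0,1]^d)$, $T_f\in BV([0,1]^d)^*$ is $T_f(u)=\int_{[0,1]^d}fu$. $SCH([0,1]^d)$ is the closure of $\{T_f: f\in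 L^d([0,1]^d)\}$ in $BV([0,1]^d)^*$ (operator norm). A $BV$-subset of $[0,1]^d$ is a measurable $B\subseteq[0,1]^d$ with finite perimeter $\|B\|=\|D\mathbf{1}_B\|(\mathbb{R}^d)<\infty$ (figures are $BV$-sets). A strong charge is a function on the $BV$-subsets of $[0,1]^d$ of the form $B\mapsto\alpha(\mathbf{1}_B)$ with $\alpha\in SCH([0,1]^d)$. A function $f\in C_0([0,1]^d)$ is strongly chargeable if $\Delta_f$ (defined on figures) extends to a strong charge. *)

theory Defs
  imports "HOL-Probability.Probability"
begin

text \<open>
  The dimension \<open>d\<close> is \<open>CARD('n)\<close>. Functions on the unit cube are total functions on
  \<open>real ^ 'n\<close> whose values outside the cube are never used.
\<close>

abbreviation unit_cube :: "(real ^ 'n) set"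
  where "unit_cube \<equiv> cbox 0 1"

definition C0_cube :: "(real ^ 'n \<Rightarrow> real) set"
  where "C0_cube = {f. continuous_on unit_cube f \<and>
    (\<forall>x\<in>unit_cube. (\<exists>i. x $ i = 0) \<longrightarrow> f x = 0)}"

subsection \<open>Increments over rectangles and figures\<close>

definition rectangle :: "real ^ 'n \<Rightarrow> real ^ 'n \<Rightarrow> bool"
  where "rectangle a b \<longleftrightarrow> (\<forall>i. a $ i < b $ i) \<and> cbox a b \<subseteq> unit_cube"

definition rect_increment :: "(real ^ 'n \<Rightarrow> real) \<Rightarrow> real ^ 'n \<Rightarrow> real ^ 'n \<Rightarrow> real"
  where "rect_increment f a b =
    (\<Sum>c\<in>{c. \<forall>i. c $ i \<in> {a $ i, b $ i}}. (- 1) ^ card {i. c $ i = a $ i} * f c)"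

definition figure :: "(real ^ 'n) set \<Rightarrow> bool"
  where "figure F \<longleftrightarrow> (\<exists>\<K>. finite \<K> \<and> (\<forall>K\<in>\<K>. \<exists>a b. rectangle a b \<and> K = cbox a b) \<and> F = \<Union>\<K>)"

text \<open>\<open>D\<close> is the additive extension of the rectangle increments of \<open>f\<close> to figures. The values of
  \<open>D\<close> on figures are uniquely determined by \<open>f\<close>; the values elsewhere are irrelevant.\<close>

definition has_figure_increment :: "(real ^ 'n \<Rightarrow> real) \<Rightarrow> ((real ^ 'n) set \<Rightarrow> real) \<Rightarrow> bool"
  where "has_figure_increment f D \<longleftrightarrow>
    (\<forall>a b. rectangle a b \<longrightarrow> D (cbox a b) = rect_increment f a b) \<and>
    (\<forall>F G. figure F \<longrightarrow> figure G \<longrightarrow> negligible (F \<inter> G) \<longrightarrow> D (F \<union> G) = D F + D G)"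

subsection \<open>Functions of bounded variation\<close>

definition partial_deriv :: "'n \<Rightarrow> (real ^ 'n \<Rightarrow> real) \<Rightarrow> real ^ 'n \<Rightarrow> real"
  where "partial_deriv i f x = frechet_derivative f (at x) (axis i 1)"

primrec C_k :: "nat \<Rightarrow> (real ^ 'n \<Rightarrow> real) \<Rightarrow> bool"
  where
    "C_k 0 f \<longleftrightarrow> continuous_on UNIV f"
  | "C_k (Suc k) f \<longleftrightarrow> f differentiable_on UNIV \<and> (\<forall>i. C_k k (partial_deriv i f))"

definition test_function :: "(real ^ 'n \<Rightarrow> real) \<Rightarrow> bool"
  where "test_function \<phi> \<longleftrightarrow> (\<forall>k. C_k k \<phi>) \<and> compact (closure {x. \<phi> x \<noteq> 0})"

text \<open>The distributional gradient of \<open>u\<close> is the finite vector-valued Borel measure \<open>\<mu>\<close>. Each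
  component of \<open>\<mu>\<close> is a finite signed measure, which is written as a difference \<open>P - N\<close> of finite
  measures (Jordan decomposition); integrals against it do not depend on the choice of \<open>P\<close> and
  \<open>N\<close>. In particular \<open>\<mu>\<close> is countably additive on Borel sets.\<close>

definition has_distr_gradient :: "(real ^ 'n \<Rightarrow> real) \<Rightarrow> ((real ^ 'n) set \<Rightarrow> real ^ 'n) \<Rightarrow> bool"
  where "has_distr_gradient u \<mu> \<longleftrightarrow>
    (\<forall>i. \<exists>P N. finite_measure P \<and> sets P = sets borel \<and> finite_measure N \<and> sets N = sets borel \<and>
      (\<forall>A\<in>sets borel. \<mu> A $ i = measure P A - measure N A) \<and>
      (\<forall>\<phi>. test_function \<phi> \<longrightarrow>
        (\<integral>x. u x * partial_deriv i \<phi> x \<partial>lebesgue) = - ((\<integral>x. \<phi> x \<partial>P) - (\<integral>x. \<phi> x \<partial>N))))"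

text \<open>The choice is unique on Borel sets whenever such a measure exists.\<close>

definition distr_gradient :: "(real ^ 'n \<Rightarrow> real) \<Rightarrow> (real ^ 'n) set \<Rightarrow> real ^ 'n"
  where "distr_gradient u = (SOME \<mu>. has_distr_gradient u \<mu>)"

definition total_variation :: "((real ^ 'n) set \<Rightarrow> real ^ 'n) \<Rightarrow> (real ^ 'n) set \<Rightarrow> ennreal"
  where "total_variation \<mu> S =
    (SUP A\<in>{A :: nat \<Rightarrow> (real ^ 'n) set.
        range A \<subseteq> sets borel \<and> disjoint_family A \<and> (\<Union>k. A k) = S}.
      \<Sum>k. ennreal (norm (\<mu> (A k))))"

definition BV :: "(real ^ 'n \<Rightarrow> real) set"
  where "BV = {u. integrable lebesgue u \<and> (\<exists>\<mu>. has_distr_gradient u \<mu>)}"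

definition BV_cube :: "(real ^ 'n \<Rightarrow> real) set"
  where "BV_cube = {u\<in>BV. AE x in lebesgue. x \<notin> unit_cube \<longrightarrow> u x = 0}"

definition bv_norm :: "(real ^ 'n \<Rightarrow> real) \<Rightarrow> ennreal"
  where "bv_norm u =
    (\<integral>\<^sup>+x. ennreal \<bar>u x\<bar> \<partial>lebesgue) + total_variation (distr_gradient u) UNIV"

subsection \<open>Strong charges\<close>

text \<open>Functionals act on representatives of elements of \<open>BV_cube\<close>. The operator norm is
  \<open>\<infinity>\<close> for unbounded functionals; a linear functional of finite norm vanishes on functions
  of zero BV norm, so it respects almost everywhere equality.\<close>

definition bv_dual_norm :: "((real ^ 'n \<Rightarrow> real) \<Rightarrow> real) \<Rightarrow> ennreal"
  where "bv_dual_norm \<alpha> = (SUP u\<in>{u\<in>BV_cube. bv_norm u \<le> 1}. ennreal \<bar>\<alpha> u\<bar>)"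

definition BV_dual :: "((real ^ 'n \<Rightarrow> real) \<Rightarrow> real) set"
  where "BV_dual = {\<alpha>.
    (\<forall>u\<in>BV_cube. \<forall>v\<in>BV_cube. \<alpha> (\<lambda>x. u x + v x) = \<alpha> u + \<alpha> v) \<and>
    (\<forall>u\<in>BV_cube. \<forall>c. \<alpha> (\<lambda>x. c * u x) = c * \<alpha> u) \<and>
    bv_dual_norm \<alpha> < \<infinity>}"

definition Ld_cube :: "(real ^ 'n \<Rightarrow> real) set"
  where "Ld_cube = {f. set_borel_measurable lebesgue unit_cube f \<and>
    set_integrable lebesgue unit_cube (\<lambda>x. \<bar>f x\<bar> ^ CARD('n))}"

definition T_functional :: "(real ^ 'n \<Rightarrow> real) \<Rightarrow> (real ^ 'n \<Rightarrow> real) \<Rightarrow> real"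
  where "T_functional f u = (LINT x:unit_cube|lebesgue. f x * u x)"

definition SCH :: "((real ^ 'n \<Rightarrow> real) \<Rightarrow> real) set"
  where "SCH = {\<alpha>\<in>BV_dual.
    \<forall>\<epsilon>>0. \<exists>f\<in>Ld_cube. bv_dual_norm (\<lambda>u. \<alpha> u - T_functional f u) < ennreal \<epsilon>}"

definition BV_set :: "(real ^ 'n) set \<Rightarrow> bool"
  where "BV_set B \<longleftrightarrow> B \<in> sets lebesgue \<and> B \<subseteq> unit_cube \<and> indicat_real B \<in> BV"

definition strong_charge :: "((real ^ 'n) set \<Rightarrow> real) \<Rightarrow> bool"
  where "strong_charge \<nu> \<longleftrightarrow> (\<exists>\<alpha>\<in>SCH. \<forall>B. BV_set B \<longrightarrow> \<nu> B = \<alpha> (indicat_real B))"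

definition strongly_chargeable :: "(real ^ 'n \<Rightarrow> real) \<Rightarrow> bool"
  where "strongly_chargeable f \<longleftrightarrow>
    (\<exists>D \<nu>. has_figure_increment f D \<and> strong_charge \<nu> \<and> (\<forall>F. figure F \<longrightarrow> \<nu> F = D F))"

subsection \<open>The Brownian sheet\<close>

text \<open>Point masses count as (degenerate) Gaussian laws; \<open>W\<close> vanishes almost surely where a
  coordinate is zero.\<close>

definition gaussian_rv :: "'w measure \<Rightarrow> ('w \<Rightarrow> real) \<Rightarrow> bool"
  where "gaussian_rv M X \<longleftrightarrow> X \<in> borel_measurable M \<and>
    ((\<exists>m. AE \<omega> in M. X \<omega> = m) \<or>
     (\<exists>m \<sigma>. \<sigma> > 0 \<and> distributed M lborel X (\<lambda>x. ennreal (normal_density m \<sigma> x))))"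

definition gaussian_process :: "'w measure \<Rightarrow> 't set \<Rightarrow> ('t \<Rightarrow> 'w \<Rightarrow> real) \<Rightarrow> bool"
  where "gaussian_process M T X \<longleftrightarrow>
    (\<forall>S c. finite S \<longrightarrow> S \<subseteq> T \<longrightarrow> gaussian_rv M (\<lambda>\<omega>. \<Sum>t\<in>S. c t * X t \<omega>))"

definition brownian_sheet :: "'w measure \<Rightarrow> (real ^ 'n \<Rightarrow> 'w \<Rightarrow> real) \<Rightarrow> bool"
  where "brownian_sheet M W \<longleftrightarrow>
    gaussian_process M unit_cube W \<and>
    (\<forall>t\<in>unit_cube. (\<integral>\<omega>. W t \<omega> \<partial>M) = 0) \<and>
    (\<forall>s\<in>unit_cube. \<forall>t\<in>unit_cube. (\<integral>\<omega>. W s \<omega> * W t \<omega> \<partial>M) = (\<Prod>i\<in>UNIV. min (s $ i) (t $ i)))"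

end

theory Submission
  imports Defs
begin

text \<open>
  Let \<open>d = CARD('n)\<close>. Cut the cube into the \<open>N ^ d\<close> grid cells of side \<open>1 / N\<close>, and let \<open>V\<close> be the
  sum of the absolute values of the increments of a function over these cells. The proof compares
  the size of \<open>V\<close> for the two properties in question.

  For a strongly chargeable function, \<open>V / N\<close> tends to \<open>0\<close>. Any union \<open>B\<close> of cells has perimeter at
  most \<open>2 * d * N\<close>, the total area of the faces of all cells, so for \<open>c\<close> of order \<open>1 / N\<close> the function
  \<open>c * indicat_real B\<close> lies in the unit ball of \<open>BV\<close> and is uniformly small. A functional that is
  approximated in operator norm by integration against integrable functions is therefore small
  on it, which says that the increment over \<open>B\<close> is \<open>o(N)\<close>, uniformly in \<open>B\<close>. Taking for \<open>B\<close> the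
  cells with nonnegative increment, and then the remaining cells, gives the claim about \<open>V\<close>
  (\<open>strongly_chargeable_imp_grid_variation_small\<close>).

  For the Brownian sheet, \<open>V / N\<close> does not tend to \<open>0\<close>. The increments over the cells are
  uncorrelated centered Gaussians of variance \<open>N ^ - d\<close>. Once normalized to variance \<open>1\<close>, the mean
  of their absolute values over the \<open>N ^ d\<close> cells is \<open>V\<close> divided by the square root of \<open>N ^ d\<close>, hence
  at most \<open>V / N\<close> because \<open>d \<ge> 2\<close>. This mean is bounded below by the mean of \<open>1 - cos\<close> of the
  normalized increments, and the latter is close to \<open>1 - exp (- 1 / 2) > 0\<close> in mean square, since
  the cosines are again uncorrelated (\<open>cos_increments_uncorrelated\<close>). Fatou's lemma turns this into the
  almost sure statement \<open>AE_liminf_mean_cos\<close>.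

  The perimeter bound needs an explicit distributional gradient of \<open>u = c * indicat_real B\<close>
  (\<open>grid_step_gradient\<close>) and the fact that distributional gradients are unique
  (\<open>has_distr_gradient_unique\<close>), which rests on smooth bump functions that approximate the
  indicators of boxes.
\<close>

section \<open>Smooth bumps and uniqueness of distributional gradients\<close>

text \<open>
  The case \<open>m = 0\<close> is the classical flat function. The negative powers of
  \<open>s\<close> are there because they appear in all its derivatives.
\<close>

definition flat_exp :: "nat \<Rightarrow> real \<Rightarrow> real"
  where "flat_exp m s = (if s > 0 then inverse s ^ m * exp (- inverse s) else 0)"

lemma flat_exp_mult: "s * flat_exp (Suc m) s = flat_exp m s"
  by (simp add: flat_exp_def)

lemma flat_exp_tendsto_0: "(flat_exp m \<longlongrightarrow> 0) (at 0)"
proof -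
  have "((\<lambda>s::real. inverse s ^ m / exp (inverse s)) \<longlongrightarrow> 0) (at_right 0)"
    by (rule filterlim_compose[OF tendsto_power_div_exp_0 filterlim_inverse_at_top_right])
  then have "(flat_exp m \<longlongrightarrow> 0) (at_right 0)"
    by (rule Lim_transform_eventually)
       (auto simp: flat_exp_def eventually_at_filter exp_minus divide_inverse)
  moreover have "(flat_exp m \<longlongrightarrow> 0) (at_left 0)"
    by (rule tendsto_eventually) (auto simp: flat_exp_def eventually_at_filter)
  ultimately show ?thesis
    by (simp add: filterlim_at_split)
qed

text \<open>
  At \<open>0\<close> the difference quotient of the function of index \<open>m\<close> is the
  function of index \<open>Suc m\<close>, by \<open>flat_exp_mult\<close>, and so tends to
  \<open>0\<close>.
\<close>

lemma flat_exp_deriv: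
  "(flat_exp m has_real_derivative flat_exp (m + 2) s - real m * flat_exp (Suc m) s) (at s)"
proof -
  consider "s > 0" | "s < 0" | "s = 0" by linarith
  then show ?thesis
  proof cases
    case 1
    have D: "((\<lambda>s. inverse s ^ m * exp (- inverse s)) has_real_derivative
        real m * (- (inverse s ^ Suc (Suc 0)) * inverse s ^ (m - Suc 0)) * exp (- inverse s)
        + (exp (- inverse s) * inverse s ^ Suc (Suc 0)) * inverse s ^ m) (at s)"
      by (rule derivative_eq_intros refl | use 1 in simp)+
    have ev: "eventually (\<lambda>t. inverse t ^ m * exp (- inverse t) = flat_exp m t) (nhds s)"
      by (rule eventually_mono[OF eventually_nhds_in_open[of "{0<..}"]])
         (use 1 in \<open>simp_all add: flat_exp_def\<close>)
    show ?thesis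
      using D 1 unfolding DERIV_cong_ev[OF refl ev refl]
      by (cases m) (simp_all add: flat_exp_def algebra_simps)
  next
    case 2
    have ev: "eventually (\<lambda>t. 0 = flat_exp m t) (nhds s)"
      by (rule eventually_mono[OF eventually_nhds_in_open[of "{..<0}"]])
         (use 2 in \<open>simp_all add: flat_exp_def\<close>)
    show ?thesis
      using 2 unfolding DERIV_cong_ev[OF refl ev refl, symmetric]
      by (simp add: flat_exp_def)
  next
    case 3
    have "flat_exp (Suc m) t = flat_exp m t / t" if "t \<noteq> 0" for t
      using that flat_exp_mult[of t m] by (simp add: field_simps)
    then have "eventually (\<lambda>t. flat_exp (Suc m) t = (flat_exp m t - flat_exp m 0) / (t - 0)) (at 0)"
      by (simp add: eventually_at_filter flat_exp_def[of _ 0])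
    then have "((\<lambda>t. (flat_exp m t - flat_exp m 0) / (t - 0)) \<longlongrightarrow> 0) (at 0)"
      by (rule Lim_transform_eventually[OF flat_exp_tendsto_0])
    then show ?thesis
      using 3 by (simp add: has_field_derivative_iff flat_exp_def)
  qed
qed

text \<open>
  For a polynomial \<open>s\<close>, the \<open>k\<close>-th derivative of \<open>exp (- 1 /
  s)\<close> is \<open>p / s ^ (2 * k) * exp (- 1 / s)\<close> with a polynomial \<open>p\<close>.
  The recursion for these numerators is the quotient rule over the common denominator \<open>s ^
  (2 * k + 2)\<close>.
\<close>

primrec bump_num :: "real poly \<Rightarrow> nat \<Rightarrow> real poly"
  where
    "bump_num s 0 = 1"
  | "bump_num s (Suc k) = pderiv (bump_num s k) * s\<^sup>2
      - of_nat (2 * k) * bump_num s k * pderiv s * s + bump_num s k * pderiv s"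

definition bump_deriv :: "real poly \<Rightarrow> nat \<Rightarrow> real \<Rightarrow> real"
  where "bump_deriv s k t = poly (bump_num s k) t * flat_exp (2 * k) (poly s t)"

lemma bump_deriv_deriv:
  "(bump_deriv s k has_real_derivative bump_deriv s (Suc k) t) (at t)"
proof -
  let ?p = "bump_num s k" and ?x = "poly s t"
  have "(bump_deriv s k has_real_derivative
     poly (pderiv ?p) t * flat_exp (2 * k) ?x + poly ?p t *
       ((flat_exp (2 * k + 2) ?x - real (2 * k) * flat_exp (Suc (2 * k)) ?x) * poly (pderiv s) t))
     (at t)"
    unfolding bump_deriv_def
    using DERIV_mult[OF poly_DERIV[of ?p t] DERIV_chain2[OF flat_exp_deriv[of "2 * k"] poly_DERIV[of s t]]]
    by (simp add: algebra_simps)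
  moreover have "flat_exp (2 * k) ?x = ?x * (?x * flat_exp (2 * k + 2) ?x)"
    and "flat_exp (Suc (2 * k)) ?x = ?x * flat_exp (2 * k + 2) ?x"
    by (simp_all add: flat_exp_mult)
  then have "poly (pderiv ?p) t * flat_exp (2 * k) ?x + poly ?p t *
       ((flat_exp (2 * k + 2) ?x - real (2 * k) * flat_exp (Suc (2 * k)) ?x) * poly (pderiv s) t)
     = bump_deriv s (Suc k) t"
    by (simp only:) (simp add: bump_deriv_def of_nat_poly algebra_simps power2_eq_square)
  ultimately show ?thesis
    by simp
qed

text \<open>
  A partial derivative in direction \<open>j\<close> only raises the order of the
  \<open>j\<close>-th factor by one. Products of this form, with arbitrary orders
  \<open>m\<close>, are thus closed under partial derivatives, which makes the induction in
  \<open>C_k_prod\<close> work.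
\<close>

lemma partial_deriv_prod:
  fixes g :: "'n::finite \<Rightarrow> nat \<Rightarrow> real \<Rightarrow> real"
  assumes g: "\<And>i k t. (g i k has_real_derivative g i (Suc k) t) (at t)"
  shows "(\<lambda>x :: real ^ 'n. \<Prod>i\<in>UNIV. g i (m i) (x $ i)) differentiable at x" (is "?f differentiable _")
    and "partial_deriv j (\<lambda>x :: real ^ 'n. \<Prod>i\<in>UNIV. g i (m i) (x $ i)) x
      = (\<Prod>i\<in>UNIV. g i ((m(j := Suc (m j))) i) (x $ i))"
proof -
  have D: "((\<lambda>x. g i (m i) (x $ i)) has_derivative (\<lambda>h. g i (Suc (m i)) (x $ i) * h $ i)) (at x)" for i
  proof -
    have "((\<lambda>x :: real ^ 'n. x $ i) has_derivative (\<lambda>h. h $ i)) (at x)"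
      by (intro bounded_linear_imp_has_derivative bounded_linear_vec_nth)
    from DERIV_compose_FDERIV[OF g this] show ?thesis
      by (simp add: mult.commute)
  qed
  have F: "(?f has_derivative (\<lambda>h. \<Sum>i\<in>UNIV. g i (Suc (m i)) (x $ i) * h $ i *
      (\<Prod>j\<in>UNIV - {i}. g j (m j) (x $ j)))) (at x)"
    by (rule has_derivative_prod) (rule D)
  then show "?f differentiable at x"
    by (auto simp: differentiable_def)
  have "partial_deriv j ?f x = (\<Sum>i\<in>UNIV. g i (Suc (m i)) (x $ i) * axis j 1 $ i *
      (\<Prod>j\<in>UNIV - {i}. g j (m j) (x $ j)))"
    unfolding partial_deriv_def by (subst frechet_derivative_at[OF F, symmetric]) simp
  also have "\<dots> = (\<Sum>i\<in>{j}. g i (Suc (m i)) (x $ i) * (\<Prod>j\<in>UNIV - {i}. g j (m j) (x $ j)))"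
    by (rule sum.mono_neutral_cong_right) (auto simp: axis_def)
  also have "\<dots> = g j (Suc (m j)) (x $ j) * (\<Prod>i\<in>UNIV - {j}. g i ((m(j := Suc (m j))) i) (x $ i))"
    by simp
  also have "\<dots> = (\<Prod>i\<in>UNIV. g i ((m(j := Suc (m j))) i) (x $ i))"
    by (simp add: prod.remove[of UNIV j "\<lambda>i. g i ((m(j := Suc (m j))) i) (x $ i)"] del: fun_upd_apply) simp
  finally show "partial_deriv j ?f x = \<dots>" .
qed

lemma C_k_prod:
  fixes g :: "'n::finite \<Rightarrow> nat \<Rightarrow> real \<Rightarrow> real"
  assumes g: "\<And>i k t. (g i k has_real_derivative g i (Suc k) t) (at t)"
  shows "C_k k (\<lambda>x :: real ^ 'n. \<Prod>i\<in>UNIV. g i (m i) (x $ i))"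
proof (induction k arbitrary: m)
  case 0
  show ?case
    using partial_deriv_prod(1)[where m = m and g = g, OF g]
    by (auto intro!: continuous_at_imp_continuous_on differentiable_imp_continuous_within)
next
  case (Suc k)
  have "partial_deriv j (\<lambda>x :: real ^ 'n. \<Prod>i\<in>UNIV. g i (m i) (x $ i))
      = (\<lambda>x. \<Prod>i\<in>UNIV. g i ((m(j := Suc (m j))) i) (x $ i))" for j
    using partial_deriv_prod(2)[where m = m and g = g, OF g] by blast
  then show ?case
    using Suc partial_deriv_prod(1)[where m = m and g = g, OF g]
    by (simp add: differentiable_on_def differentiable_at_withinI)
qed


text \<open>
  The polynomial \<open>(t - a) * (b - t)\<close> is positive exactly on the interval, so the
  product is positive exactly on the open box. The factor \<open>Suc n\<close> makes the exponent
  tend to \<open>0\<close> there, so that the bumps converge to the indicator of the box.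
\<close>

definition box_bump :: "real ^ 'n \<Rightarrow> real ^ 'n \<Rightarrow> nat \<Rightarrow> real ^ 'n \<Rightarrow> real"
  where "box_bump a b n x =
    (\<Prod>i\<in>UNIV. bump_deriv (smult (real (Suc n)) ([:- a $ i, 1:] * [:b $ i, -1:])) 0 (x $ i))"

lemma box_bump_eq:
  "box_bump a b n x = (\<Prod>i\<in>UNIV. flat_exp 0 (real (Suc n) * ((x $ i - a $ i) * (b $ i - x $ i))))"
proof -
  have "poly (smult (real (Suc n)) ([:- a $ i, 1:] * [:b $ i, -1:])) (x $ i)
      = real (Suc n) * ((x $ i - a $ i) * (b $ i - x $ i))" for i
    by (simp add: algebra_simps)
  then show ?thesis
    by (simp add: box_bump_def bump_deriv_def del: poly_smult)
qed

lemma box_bump_bounds: "0 \<le> box_bump a b n x" "box_bump a b n x \<le> 1"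
  unfolding box_bump_eq by (auto intro!: prod_nonneg prod_le_1 simp: flat_exp_def simp del: inverse_mult_distrib)

lemma box_bump_eq_0:
  assumes "\<And>i. a $ i < b $ i" "x \<notin> box a b"
  shows "box_bump a b n x = 0"
proof -
  obtain i where "x $ i \<le> a $ i \<or> b $ i \<le> x $ i"
    using assms(2) by (auto simp: mem_box_cart not_less)
  with assms(1)[of i] have "(x $ i - a $ i) * (b $ i - x $ i) \<le> 0"
    by (auto simp: mult_le_0_iff)
  then have "real (Suc n) * ((x $ i - a $ i) * (b $ i - x $ i)) \<le> 0"
    by (rule mult_nonneg_nonpos[rotated]) simp
  then have "flat_exp 0 (real (Suc n) * ((x $ i - a $ i) * (b $ i - x $ i))) = 0"
    unfolding flat_exp_def by auto
  then show ?thesis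
    unfolding box_bump_eq by (intro prod_zero) auto
qed

lemma box_bump_LIMSEQ:
  assumes "\<And>i. a $ i < b $ i"
  shows "(\<lambda>n. box_bump a b n x) \<longlonglongrightarrow> indicat_real (box a b) x"
proof (cases "x \<in> box a b")
  case True
  have "(\<lambda>n. flat_exp 0 (real (Suc n) * c)) \<longlonglongrightarrow> 1" if "c > 0" for c
  proof -
    have "filterlim (\<lambda>n. c * real (Suc n)) at_top sequentially"
      by (intro filterlim_tendsto_pos_mult_at_top[OF tendsto_const that]
          filterlim_compose[OF filterlim_real_sequentially filterlim_Suc])
    then have "(\<lambda>n. inverse (c * real (Suc n))) \<longlonglongrightarrow> 0"
      by (rule tendsto_inverse_0_at_top)
    from tendsto_exp[OF tendsto_minus[OF this]] show ?thesis
      using that by (simp add: flat_exp_def mult.commute)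
  qed
  then have "(\<lambda>n. box_bump a b n x) \<longlonglongrightarrow> (\<Prod>i\<in>(UNIV :: 'a set). 1)"
    unfolding box_bump_eq by (intro tendsto_prod) (use True in \<open>auto simp: mem_box_cart\<close>)
  with True show ?thesis by simp
qed (use assms in \<open>simp add: box_bump_eq_0\<close>)

lemma test_function_box_bump:
  assumes "\<And>i. a $ i < b $ i"
  shows "test_function (box_bump a b n)"
proof -
  have "C_k k (box_bump a b n)" for k
    unfolding box_bump_def
    using C_k_prod[where k = k and m = "\<lambda>_. 0"
        and g = "\<lambda>i. bump_deriv (smult (real (Suc n)) ([:- a $ i, 1:] * [:b $ i, -1:]))"]
    by (simp add: bump_deriv_deriv)
  moreover have "closure {x. box_bump a b n x \<noteq> 0} \<subseteq> cbox a b"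
    using box_bump_eq_0[OF assms] box_subset_cbox[of a b]
    by (intro closure_minimal) (auto simp: closed_cbox)
  then have "compact (closure {x. box_bump a b n x \<noteq> 0})"
    using compact_Int_closed[OF compact_cbox closed_closure] by (metis inf.absorb2)
  ultimately show ?thesis
    by (simp add: test_function_def)
qed

lemma test_function_continuous: "test_function \<phi> \<Longrightarrow> continuous_on UNIV \<phi>"
  unfolding test_function_def using C_k.simps(1) by blast

text \<open>
  Dominated convergence along \<open>box_bump\<close> carries the equality from test functions to
  open boxes; these are closed under intersection and generate the Borel sets. Writing the
  equality of the signed measures \<open>P - N\<close> and \<open>P' - N'\<close> with sums keeps
  all terms nonnegative.
\<close>

lemma measure_sum_eqI_test_function:
  fixes P N P' N' :: "(real ^ 'n) measure"
  assumes P: "finite_measure P" "sets P = sets borel" and N: "finite_measure N" "sets N = sets borel"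
    and P': "finite_measure P'" "sets P' = sets borel" and N': "finite_measure N'" "sets N' = sets borel"
    and eq: "\<And>\<phi>. test_function \<phi> \<Longrightarrow>
      (\<integral>x. \<phi> x \<partial>P) + (\<integral>x. \<phi> x \<partial>N') = (\<integral>x. \<phi> x \<partial>P') + (\<integral>x. \<phi> x \<partial>N)"
    and A: "A \<in> sets borel"
  shows "measure P A + measure N' A = measure P' A + measure N A"
proof -
  interpret P: finite_measure P by fact
  interpret N: finite_measure N by fact
  interpret P': finite_measure P' by fact
  interpret N': finite_measure N' by fact
  define E where "E A \<longleftrightarrow> measure P A + measure N' A = measure P' A + measure N A" for A :: "(real ^ 'n) set"
  have box: "E (box a b)" for a b :: "real ^ 'n"
  proof (cases "\<forall>i. a $ i < b $ i")
    case True
    have lim: "(\<lambda>n. \<integral>x. box_bump a b n x \<partial>Q) \<longlonglongrightarrow> measure Q (box a b)"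
      if "finite_measure Q" "sets Q = sets borel" for Q
    proof -
      interpret finite_measure Q by fact
      have m: "borel_measurable Q = borel_measurable borel"
        using that by (simp cong: measurable_cong_sets)
      have "(\<lambda>n. \<integral>x. box_bump a b n x \<partial>Q) \<longlonglongrightarrow> (\<integral>x. indicat_real (box a b) x \<partial>Q)"
      proof (rule integral_dominated_convergence[where w = "\<lambda>_. 1"])
        show "box_bump a b n \<in> borel_measurable Q" for n
          unfolding m using True
          by (intro borel_measurable_continuous_onI test_function_continuous test_function_box_bump) auto
        show "AE x in Q. (\<lambda>n. box_bump a b n x) \<longlonglongrightarrow> indicat_real (box a b) x"
          using box_bump_LIMSEQ[of a b] True by auto
        show "AE x in Q. norm (box_bump a b n x) \<le> 1" for n
          using box_bump_bounds[of a b n] by auto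
      qed (use that in auto)
      then show ?thesis
        using that by simp
    qed
    have "(\<lambda>n. (\<integral>x. box_bump a b n x \<partial>P) + (\<integral>x. box_bump a b n x \<partial>N'))
        \<longlonglongrightarrow> measure P (box a b) + measure N' (box a b)"
      by (intro tendsto_add lim P N')
    moreover have "(\<lambda>n. (\<integral>x. box_bump a b n x \<partial>P) + (\<integral>x. box_bump a b n x \<partial>N'))
        \<longlonglongrightarrow> measure P' (box a b) + measure N (box a b)"
      using True by (subst eq[OF test_function_box_bump]) (auto intro!: tendsto_add lim P' N)
    ultimately show ?thesis
      unfolding E_def by (rule LIMSEQ_unique)
  next
    case False
    then have "box a b = {}"
      by (auto simp: mem_box_cart) (meson less_trans)
    then show ?thesis by (simp add: E_def)
  qed
  have UN: "E (\<Union>k::nat. B k)" if B: "range B \<subseteq> sets borel" and disj: "disjoint_family B"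
    and E: "\<And>k. E (B k)" for B :: "nat \<Rightarrow> (real ^ 'n) set"
  proof -
    have "(\<lambda>k. measure P (B k) + measure N' (B k)) sums (measure P (\<Union>k. B k) + measure N' (\<Union>k. B k))"
      using B disj P P' N N' by (intro sums_add P.finite_measure_UNION N'.finite_measure_UNION) auto
    moreover have "(\<lambda>k. measure P' (B k) + measure N (B k)) sums (measure P' (\<Union>k. B k) + measure N (\<Union>k. B k))"
      using B disj P P' N N' by (intro sums_add P'.finite_measure_UNION N.finite_measure_UNION) auto
    ultimately show ?thesis
      using E unfolding E_def by (simp only:) (rule sums_unique2)
  qed
  have univ: "E UNIV"
  proof -
    define B where "B k = box (- (real k *\<^sub>R One)) (real k *\<^sub>R One :: real ^ 'n)" for k
    have inc: "incseq B"
      unfolding B_def by (intro monoI subset_box_imp) (simp add: inner_sum_left_Basis del: One_nat_def)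
    have U: "(\<Union>k. B k) = UNIV"
      unfolding B_def by (rule UN_box_eq_UNIV)
    have lim: "(\<lambda>k. measure Q (B k)) \<longlonglongrightarrow> measure Q UNIV"
      if "finite_measure Q" "sets Q = sets borel" for Q
    proof -
      interpret finite_measure Q by fact
      show ?thesis
        using finite_Lim_measure_incseq[OF _ inc] that(2) unfolding U by (simp add: B_def image_subset_iff)
    qed
    have "(\<lambda>k. measure P (B k) + measure N' (B k)) \<longlonglongrightarrow> measure P UNIV + measure N' UNIV"
      by (intro tendsto_add lim P N')
    moreover have "measure P (B k) + measure N' (B k) = measure P' (B k) + measure N (B k)" for k
      using box unfolding E_def B_def by blast
    moreover have "(\<lambda>k. measure P' (B k) + measure N (B k)) \<longlonglongrightarrow> measure P' UNIV + measure N UNIV"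
      by (intro tendsto_add lim P' N)
    ultimately show ?thesis
      unfolding E_def by (simp only:) (rule LIMSEQ_unique)
  qed
  have "Int_stable (range (\<lambda>(a, b). box a b :: (real ^ 'n) set))"
    by (auto simp: Int_stable_def box_Int_box)
  moreover have "range (\<lambda>(a, b). box a b :: (real ^ 'n) set) \<subseteq> Pow UNIV"
    by simp
  moreover have "A \<in> sigma_sets UNIV (range (\<lambda>(a, b). box a b))"
    using A unfolding borel_eq_box by simp
  ultimately have "E A"
  proof (induction rule: sigma_sets_induct_disjoint)
    case (basic A) then show ?case using box by auto
  next
    case empty then show ?case by (simp add: E_def)
  next
    case (compl A)
    then have "A \<in> sets borel" unfolding borel_eq_box by simp
    then show ?case
      using compl univ P P' N N' P.finite_measure_compl[of A] N.finite_measure_compl[of A]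
        P'.finite_measure_compl[of A] N'.finite_measure_compl[of A]
      by (simp add: E_def sets_eq_imp_space_eq[OF P(2)] sets_eq_imp_space_eq[OF N(2)]
         sets_eq_imp_space_eq[OF P'(2)] sets_eq_imp_space_eq[OF N'(2)])
  next
    case (union B)
    then show ?case by (intro UN) (auto simp: borel_eq_box[where 'a = "real ^ 'n"])
  qed
  then show ?thesis
    by (simp add: E_def)
qed

text \<open>
  Since \<open>distr_gradient\<close> is a choice, its total variation can only be estimated
  through this uniqueness, from a gradient that is known explicitly.
\<close>

lemma has_distr_gradient_unique:
  fixes u :: "real ^ 'n \<Rightarrow> real"
  assumes \<mu>: "has_distr_gradient u \<mu>" and \<nu>: "has_distr_gradient u \<nu>" and A: "A \<in> sets borel"
  shows "\<mu> A = \<nu> A"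
proof (rule vec_eq_iff[THEN iffD2], rule allI)
  fix i
  from \<mu>[unfolded has_distr_gradient_def, THEN spec[of _ i]] obtain P N
    where P: "finite_measure P" "sets P = sets borel" and N: "finite_measure N" "sets N = sets borel"
      and \<mu>_eq: "\<forall>A\<in>sets borel. \<mu> A $ i = measure P A - measure N A"
      and \<mu>_int: "\<forall>\<phi>. test_function \<phi> \<longrightarrow>
        (\<integral>x. u x * partial_deriv i \<phi> x \<partial>lebesgue) = - ((\<integral>x. \<phi> x \<partial>P) - (\<integral>x. \<phi> x \<partial>N))"
    by (elim exE conjE)
  from \<nu>[unfolded has_distr_gradient_def, THEN spec[of _ i]] obtain P' N'
    where P': "finite_measure P'" "sets P' = sets borel" and N': "finite_measure N'" "sets N' = sets borel"
      and \<nu>_eq: "\<forall>A\<in>sets borel. \<nu> A $ i = measure P' A - measure N' A"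
      and \<nu>_int: "\<forall>\<phi>. test_function \<phi> \<longrightarrow>
        (\<integral>x. u x * partial_deriv i \<phi> x \<partial>lebesgue) = - ((\<integral>x. \<phi> x \<partial>P') - (\<integral>x. \<phi> x \<partial>N'))"
    by (elim exE conjE)
  have "measure P A + measure N' A = measure P' A + measure N A"
  proof (rule measure_sum_eqI_test_function[OF P N P' N' _ A])
    fix \<phi> :: "real ^ 'n \<Rightarrow> real" assume "test_function \<phi>"
    then have "(\<integral>x. \<phi> x \<partial>P) - (\<integral>x. \<phi> x \<partial>N) = (\<integral>x. \<phi> x \<partial>P') - (\<integral>x. \<phi> x \<partial>N')"
      using \<mu>_int[THEN spec[of _ \<phi>]] \<nu>_int[THEN spec[of _ \<phi>]] by linarith
    then show "(\<integral>x. \<phi> x \<partial>P) + (\<integral>x. \<phi> x \<partial>N') = (\<integral>x. \<phi> x \<partial>P') + (\<integral>x. \<phi> x \<partial>N)"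
      by linarith
  qed
  with \<mu>_eq \<nu>_eq A show "\<mu> A $ i = \<nu> A $ i"
    by simp
qed

section \<open>The gradient of a function that is constant on grid cells\<close>

text \<open>
  This is Fubini's theorem with the coordinate along \<open>b\<close> split off. On a line that
  starts at a point with \<open>x \<bullet> b = 0\<close>, the parameter \<open>t\<close> is that
  coordinate.
\<close>

lemma lborel_integral_eq_slicewise:
  fixes F G :: "'a::euclidean_space \<Rightarrow> real"
  assumes b: "b \<in> Basis" and F: "integrable lborel F" and G: "integrable lborel G"
    and eq: "\<And>x. x \<bullet> b = 0 \<Longrightarrow> (\<integral>t. F (x + t *\<^sub>R b) \<partial>lborel) = (\<integral>t. G (x + t *\<^sub>R b) \<partial>lborel)"
  shows "(\<integral>x. F x \<partial>lborel) = (\<integral>x. G x \<partial>lborel)"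
proof -
  interpret product_sigma_finite "\<lambda>_ :: 'a. lborel :: real measure"
    by (simp add: product_sigma_finite_def sigma_finite_lborel)
  define B where "B = Basis - {b}"
  have B: "Basis = insert b B" "finite B" "b \<notin> B"
    using b by (auto simp: B_def)
  have M: "(\<lambda>f. \<Sum>c\<in>Basis. f c *\<^sub>R c) \<in> (\<Pi>\<^sub>M c\<in>Basis. lborel) \<rightarrow>\<^sub>M (borel :: 'a measure)"
    by measurable
  have split: "(\<Sum>c\<in>Basis. (f(b := t)) c *\<^sub>R c) = (\<Sum>c\<in>B. f c *\<^sub>R c) + t *\<^sub>R b" for f t
  proof -
    have "(\<Sum>c\<in>B. (f(b := t)) c *\<^sub>R c) = (\<Sum>c\<in>B. f c *\<^sub>R c)"
      using B by (intro sum.cong) auto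
    then show ?thesis
      by (simp add: B add.commute)
  qed
  have orth: "(\<Sum>c\<in>B. f c *\<^sub>R c) \<bullet> b = 0" for f
    unfolding inner_sum_left
    by (intro sum.neutral) (use b in \<open>auto simp: B_def inner_Basis\<close>)
  have fubini: "(\<integral>x. H x \<partial>lborel) = (\<integral>f. (\<integral>t. H ((\<Sum>c\<in>B. f c *\<^sub>R c) + t *\<^sub>R b) \<partial>lborel) \<partial>(\<Pi>\<^sub>M c\<in>B. lborel))"
    if H: "integrable lborel H" for H :: "'a \<Rightarrow> real"
  proof -
    have Hm: "H \<in> borel_measurable borel"
      using H by (auto dest: borel_measurable_integrable)
    have "integrable (\<Pi>\<^sub>M c\<in>Basis. lborel) (\<lambda>f. H (\<Sum>c\<in>Basis. f c *\<^sub>R c))"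
      using H unfolding lborel_eq[where 'a = 'a] integrable_distr_eq[OF M Hm] .
    moreover have "(\<integral>x. H x \<partial>lborel) = (\<integral>f. H (\<Sum>c\<in>Basis. f c *\<^sub>R c) \<partial>(\<Pi>\<^sub>M c\<in>Basis. lborel))"
      unfolding lborel_eq[where 'a = 'a] by (rule integral_distr[OF M Hm])
    ultimately show ?thesis
      using product_integral_insert[OF B(2,3), of "\<lambda>f. H (\<Sum>c\<in>Basis. f c *\<^sub>R c)"]
      unfolding split by (simp add: B(1))
  qed
  show ?thesis
    unfolding fubini[OF F] fubini[OF G] eq[OF orth] ..
qed

lemma mem_cell_iff_floor:
  fixes t :: real
  assumes "N > 0"
  shows "t \<in> {real k / real N..<real (Suc k) / real N} \<longleftrightarrow> \<lfloor>real N * t\<rfloor> = int k"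
  using assms by (auto simp: floor_eq_iff field_simps)

text \<open>
  Both integrals over the cell \<open>{k / N..<(k + 1) / N}\<close> equal \<open>v (k / N) *
  (\<psi> ((k + 1) / N) - \<psi> (k / N))\<close>: the left one by the fundamental theorem of
  calculus, the right one because its integrand is constant there and the cell has length \<open>1
  / N\<close>.
\<close>

lemma step_function_integral_by_parts:
  fixes v \<psi> \<psi>' :: "real \<Rightarrow> real"
  assumes N: "N > 0" and supp: "\<And>t. t \<notin> {0..<1} \<Longrightarrow> v t = 0"
    and step: "\<And>t. v (\<lfloor>real N * t\<rfloor> / real N) = v t"
    and \<psi>: "\<And>t. (\<psi> has_real_derivative \<psi>' t) (at t)" and \<psi>': "continuous_on UNIV \<psi>'"
  shows "(\<integral>t. v t * \<psi>' t \<partial>lborel)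
    = (\<integral>t. v t * (real N * (\<psi> ((\<lfloor>real N * t\<rfloor> + 1) / real N) - \<psi> (\<lfloor>real N * t\<rfloor> / real N))) \<partial>lborel)"
proof -
  define I where "I k = {real k / real N..<real (Suc k) / real N}" for k
  define w where "w k = \<psi> (real (Suc k) / real N) - \<psi> (real k / real N)" for k
  have le: "real k / real N \<le> real (Suc k) / real N" for k
    using N by (simp add: divide_right_mono)
  \<comment> \<open>at every point at most one cell contributes to the sum\<close>
  have expand: "v t * h t = (\<Sum>k<N. v (real k / real N) * (indicator (I k) t * h t))" for t and h :: "real \<Rightarrow> real"
  proof (cases "t \<in> {0..<1}")
    case True
    define k where "k = nat \<lfloor>real N * t\<rfloor>"
    have k: "\<lfloor>real N * t\<rfloor> = int k"
      using True by (simp add: k_def)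
    then have "real k \<le> real N * t" by linarith
    also have "\<dots> < real N" using True N by simp
    finally have "k < N" by simp
    have "(\<Sum>j<N. v (real j / real N) * (indicator (I j) t * h t))
        = (\<Sum>j<N. if j = k then v (real k / real N) * h t else 0)"
      unfolding I_def indicator_def mem_cell_iff_floor[OF N] k by (intro sum.cong) auto
    also have "\<dots> = v t * h t"
      using \<open>k < N\<close> step[of t] k by simp
    finally show ?thesis by simp
  next
    case False
    have "t \<notin> I k" if "k < N" for k
    proof
      assume "t \<in> I k"
      then have "real k / real N \<le> t" "t < real (Suc k) / real N" by (auto simp: I_def)
      moreover have "real (Suc k) / real N \<le> 1"
        using that by (auto simp: field_simps)
      moreover have "0 \<le> real k / real N" by simp
      ultimately have "0 \<le> t" "t < 1" by linarith+
      then show False using False by auto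
    qed
    then show ?thesis
      using supp[OF False] by simp
  qed
  have 1: "has_bochner_integral lborel (\<lambda>t. indicator (I k) t * \<psi>' t) (w k)" for k
  proof -
    have "has_bochner_integral lborel (\<lambda>t. indicator {real k / real N..real (Suc k) / real N} t *\<^sub>R \<psi>' t) (w k)"
      unfolding w_def using \<psi>
      by (intro has_bochner_integral_FTC_Icc le continuous_on_subset[OF \<psi>'])
         (auto simp: has_real_derivative_iff_has_vector_derivative has_vector_derivative_at_within)
    moreover have "AE t in lborel. indicator {real k / real N..real (Suc k) / real N} t *\<^sub>R \<psi>' t
        = indicator (I k) t * \<psi>' t"
      using AE_lborel_singleton[of "real (Suc k) / real N"]
      by eventually_elim (auto simp: I_def indicator_def)
    moreover have "(\<lambda>t. indicator (I k) t * \<psi>' t) \<in> borel_measurable lborel"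
      using borel_measurable_continuous_onI[OF \<psi>'] by (simp add: I_def)
    ultimately show ?thesis
      using has_bochner_integral_cong_AE[of "\<lambda>t. indicator {real k / real N..real (Suc k) / real N} t *\<^sub>R \<psi>' t"
          lborel "\<lambda>t. indicator (I k) t * \<psi>' t"]
      by (auto dest: has_bochner_integral_integrable)
  qed
  define h where "h t = real N * (\<psi> ((\<lfloor>real N * t\<rfloor> + 1) / real N) - \<psi> (\<lfloor>real N * t\<rfloor> / real N))" for t
  have 2: "has_bochner_integral lborel (\<lambda>t. indicator (I k) t * h t) (w k)" for k
  proof -
    have "has_bochner_integral lborel (\<lambda>t. indicator (I k) t * (real N * w k)) (measure lborel (I k) * (real N * w k))"
      by (intro has_bochner_integral_mult_left has_bochner_integral_real_indicator)
         (use le[of k] in \<open>auto simp: I_def simp del: of_nat_Suc\<close>)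
    moreover have "measure lborel (I k) * (real N * w k) = w k"
      using N le[of k] by (simp add: I_def field_simps)
    moreover have "indicator (I k) t * (real N * w k) = indicator (I k) t * h t" for t
      unfolding I_def indicator_def mem_cell_iff_floor[OF N] by (auto simp: w_def h_def add.commute)
    ultimately show ?thesis by simp
  qed
  have "has_bochner_integral lborel (\<lambda>t. v t * \<psi>' t) (\<Sum>k<N. v (real k / real N) * w k)"
    unfolding expand[of _ \<psi>'] by (intro has_bochner_integral_sum has_bochner_integral_mult_right 1)
  moreover have "has_bochner_integral lborel (\<lambda>t. v t * h t) (\<Sum>k<N. v (real k / real N) * w k)"
    unfolding expand[of _ h] by (intro has_bochner_integral_sum has_bochner_integral_mult_right 2)
  ultimately show ?thesis
    unfolding h_def by (simp add: has_bochner_integral_integral_eq)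
qed

text \<open>
  The next two maps project \<open>x\<close>, along the \<open>i\<close>-th axis, to the lower and
  to the upper face of the half-open grid cell that contains \<open>x\<close>.
\<close>

definition face_below :: "nat \<Rightarrow> 'n \<Rightarrow> real ^ 'n \<Rightarrow> real ^ 'n"
  where "face_below N i x = x + (\<lfloor>real N * x $ i\<rfloor> / real N - x $ i) *\<^sub>R axis i 1"

definition face_above :: "nat \<Rightarrow> 'n \<Rightarrow> real ^ 'n \<Rightarrow> real ^ 'n"
  where "face_above N i x = x + ((\<lfloor>real N * x $ i\<rfloor> + 1) / real N - x $ i) *\<^sub>R axis i 1"

lemma face_nth:
  "face_below N i x $ j = (if j = i then \<lfloor>real N * x $ i\<rfloor> / real N else x $ j)"
  "face_above N i x $ j = (if j = i then (\<lfloor>real N * x $ i\<rfloor> + 1) / real N else x $ j)"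
  by (auto simp: face_below_def face_above_def axis_def)

lemma measurable_nth_borel [measurable]: "(\<lambda>x :: real ^ 'n. x $ i) \<in> borel_measurable borel"
  by (intro borel_measurable_continuous_onI continuous_intros)

lemma measurable_face [measurable]:
  "face_below N i \<in> borel \<rightarrow>\<^sub>M borel" "face_above N i \<in> borel \<rightarrow>\<^sub>M borel"
  unfolding face_below_def face_above_def by measurable

definition half_open_cube :: "(real ^ 'n) set"
  where "half_open_cube = {x. \<forall>i. 0 \<le> x $ i \<and> x $ i < 1}"

lemma half_open_cube_subset: "half_open_cube \<subseteq> unit_cube"
  by (auto simp: half_open_cube_def mem_box_cart less_imp_le)

lemma face_in_unit_cube:
  assumes "N > 0" "x \<in> half_open_cube"
  shows "face_below N i x \<in> unit_cube" "face_above N i x \<in> unit_cube"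
proof -
  have x: "0 \<le> x $ j" "x $ j < 1" for j
    using assms(2) by (auto simp: half_open_cube_def)
  have "0 \<le> \<lfloor>real N * x $ i\<rfloor>" "real_of_int \<lfloor>real N * x $ i\<rfloor> + 1 \<le> real N"
  proof -
    show "0 \<le> \<lfloor>real N * x $ i\<rfloor>" using x by simp
    have "real N * x $ i < real N" using x assms by simp
    then have "\<lfloor>real N * x $ i\<rfloor> < int N" by linarith
    then show "real_of_int \<lfloor>real N * x $ i\<rfloor> + 1 \<le> real N" by linarith
  qed
  then have "0 \<le> \<lfloor>real N * x $ i\<rfloor> / real N" "(\<lfloor>real N * x $ i\<rfloor> + 1) / real N \<le> 1"
     "\<lfloor>real N * x $ i\<rfloor> / real N \<le> 1" "0 \<le> (\<lfloor>real N * x $ i\<rfloor> + 1) / real N"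
    using assms(1) by (auto simp: field_simps)
  then show "face_below N i x \<in> unit_cube" "face_above N i x \<in> unit_cube"
    using x by (auto simp: mem_box_cart face_nth less_imp_le)
qed

text \<open>
  Invariance under \<open>face_below N i\<close> for all \<open>i\<close> means that
  \<open>u\<close> is constant on every half-open grid cell. Cells are half-open here in order
  that they partition the space.
\<close>

definition grid_step :: "nat \<Rightarrow> (real ^ 'n \<Rightarrow> real) \<Rightarrow> bool"
  where "grid_step N u \<longleftrightarrow> (\<forall>x. 0 \<le> u x) \<and> (\<forall>x. x \<notin> half_open_cube \<longrightarrow> u x = 0) \<and>
    (\<forall>i x. u (face_below N i x) = u x) \<and> integrable lborel u"

lemma test_function_deriv:
  assumes "test_function \<phi>"
  shows "continuous_on UNIV (partial_deriv i \<phi>)"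
    and "((\<lambda>t. \<phi> (x + t *\<^sub>R axis i 1)) has_real_derivative partial_deriv i \<phi> (x + t *\<^sub>R axis i 1)) (at t)"
proof -
  have C: "C_k (Suc 0) \<phi>"
    using assms unfolding test_function_def by blast
  then show "continuous_on UNIV (partial_deriv i \<phi>)"
    by simp
  have "\<phi> differentiable (at y)" for y
    using C by (simp add: differentiable_on_def)
  then have 1: "(\<phi> has_derivative frechet_derivative \<phi> (at y)) (at y)" for y
    by (simp add: frechet_derivative_works)
  have "((\<lambda>t. \<phi> (x + t *\<^sub>R axis i 1)) has_derivative
      (\<lambda>h. frechet_derivative \<phi> (at (x + t *\<^sub>R axis i 1)) (h *\<^sub>R axis i 1))) (at t)"
    by (rule has_derivative_compose[OF _ 1]) (auto intro!: derivative_eq_intros)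
  moreover have "frechet_derivative \<phi> (at y) (h *\<^sub>R axis i 1) = h * partial_deriv i \<phi> y" for y h
    using linear_scale[OF has_derivative_linear[OF 1]] by (simp add: partial_deriv_def)
  ultimately show "((\<lambda>t. \<phi> (x + t *\<^sub>R axis i 1)) has_real_derivative
      partial_deriv i \<phi> (x + t *\<^sub>R axis i 1)) (at t)"
    by (simp add: has_field_derivative_def mult_commute_abs)
qed

lemma grid_step_integrable_mult:
  assumes u: "grid_step N u" and g: "g \<in> borel_measurable borel"
    and K: "\<And>x. x \<in> half_open_cube \<Longrightarrow> \<bar>g x\<bar> \<le> K"
  shows "integrable lborel (\<lambda>x. u x * g x)"
proof (rule Bochner_Integration.integrable_bound[of lborel "\<lambda>x. K * u x"])
  show "integrable lborel (\<lambda>x. K * u x)"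
    using u by (simp add: grid_step_def)
  show "(\<lambda>x. u x * g x) \<in> borel_measurable lborel"
    using u g by (auto simp: grid_step_def dest!: borel_measurable_integrable)
  show "AE x in lborel. norm (u x * g x) \<le> norm (K * u x)"
  proof (rule AE_I2)
    fix x
    show "norm (u x * g x) \<le> norm (K * u x)"
    proof (cases "x \<in> half_open_cube")
      case True
      then have "\<bar>g x\<bar> \<le> \<bar>K\<bar>" using K by fastforce
      then show ?thesis by (simp add: abs_mult mult.commute mult_right_mono)
    next
      case False
      then show ?thesis using u by (simp add: grid_step_def)
    qed
  qed
qed

text \<open>
  This is the divergence theorem on all cells at once. The integral of \<open>\<phi>\<close> over
  a face of a cell is expressed as \<open>N\<close> times the integral, over the cell, of
  \<open>\<phi>\<close> composed with the projection to that face, because the cell has height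
  \<open>1 / N\<close> over the face. Surface measure is thereby the image of a measure with a
  density, and the statement reduces to \<open>step_function_integral_by_parts\<close> on each
  line parallel to the \<open>i\<close>-th axis.
\<close>

lemma grid_step_gradient:
  fixes u :: "real ^ 'n \<Rightarrow> real"
  assumes N: "N > 0" and u: "grid_step N u" and \<phi>: "test_function \<phi>"
  shows "(\<integral>x. u x * partial_deriv i \<phi> x \<partial>lborel)
    = (\<integral>x. u x * (real N * \<phi> (face_above N i x)) \<partial>lborel) - (\<integral>x. u x * (real N * \<phi> (face_below N i x)) \<partial>lborel)"
    (is "?L = ?A - ?B")
proof -
  have \<phi>_cont: "continuous_on UNIV \<phi>" and D_cont: "continuous_on UNIV (partial_deriv i \<phi>)"
    using \<phi> by (auto intro: test_function_continuous test_function_deriv)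
  note [measurable] = borel_measurable_continuous_onI[OF \<phi>_cont] borel_measurable_continuous_onI[OF D_cont]
  have bounded: "\<exists>K. \<forall>x\<in>unit_cube. \<bar>g x\<bar> \<le> K" if "continuous_on UNIV g" for g :: "real ^ 'n \<Rightarrow> real"
  proof -
    have "compact (g ` unit_cube)"
      using that by (intro compact_continuous_image compact_cbox) (rule continuous_on_subset, auto)
    from compact_imp_bounded[OF this] show ?thesis
      by (auto simp: bounded_iff)
  qed
  obtain K where K: "\<And>x. x \<in> unit_cube \<Longrightarrow> \<bar>\<phi> x\<bar> \<le> K"
    using bounded[OF \<phi>_cont] by blast
  obtain K' where K': "\<And>x. x \<in> unit_cube \<Longrightarrow> \<bar>partial_deriv i \<phi> x\<bar> \<le> K'"
    using bounded[OF D_cont] by blast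
  have int: "integrable lborel (\<lambda>x. u x * (real N * \<phi> (face_above N i x)))"
      "integrable lborel (\<lambda>x. u x * (real N * \<phi> (face_below N i x)))"
    using K[OF face_in_unit_cube(1)[OF N]] K[OF face_in_unit_cube(2)[OF N]]
    by (auto intro!: grid_step_integrable_mult[OF u, where K = "real N * K"] mult_left_mono simp: abs_mult)
  have "?L = (\<integral>x. u x * (real N * \<phi> (face_above N i x)) - u x * (real N * \<phi> (face_below N i x)) \<partial>lborel)"
  proof (rule lborel_integral_eq_slicewise[of "axis i 1"])
    show "axis i 1 \<in> (Basis :: (real ^ 'n) set)" by simp
    show "integrable lborel (\<lambda>x. u x * partial_deriv i \<phi> x)"
      using K' half_open_cube_subset by (intro grid_step_integrable_mult[OF u, where K = K']) auto
    show "integrable lborel (\<lambda>x. u x * (real N * \<phi> (face_above N i x)) - u x * (real N * \<phi> (face_below N i x)))"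
      using int by (rule Bochner_Integration.integrable_diff)
    fix x :: "real ^ 'n" assume "x \<bullet> axis i 1 = 0"
    then have x: "x $ i = 0" by (simp add: inner_axis)
    have nth: "(x + t *\<^sub>R axis i 1) $ i = t" for t
      using x by simp
    have below: "face_below N i (x + t *\<^sub>R axis i 1) = x + (\<lfloor>real N * t\<rfloor> / real N) *\<^sub>R axis i 1" for t
      unfolding face_below_def nth by (simp add: scaleR_left_diff_distrib)
    have above: "face_above N i (x + t *\<^sub>R axis i 1) = x + ((\<lfloor>real N * t\<rfloor> + 1) / real N) *\<^sub>R axis i 1" for t
      unfolding face_above_def nth by (simp add: scaleR_left_diff_distrib)
    have "(\<integral>t. u (x + t *\<^sub>R axis i 1) * partial_deriv i \<phi> (x + t *\<^sub>R axis i 1) \<partial>lborel)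
       = (\<integral>t. u (x + t *\<^sub>R axis i 1) * (real N * (\<phi> (x + ((\<lfloor>real N * t\<rfloor> + 1) / real N) *\<^sub>R axis i 1)
          - \<phi> (x + (\<lfloor>real N * t\<rfloor> / real N) *\<^sub>R axis i 1))) \<partial>lborel)"
    proof (rule step_function_integral_by_parts[OF N])
      show "u (x + t *\<^sub>R axis i 1) = 0" if "t \<notin> {0..<1}" for t
      proof -
        have "x + t *\<^sub>R axis i 1 \<notin> half_open_cube"
          using that unfolding half_open_cube_def mem_Collect_eq by (metis atLeastLessThan_iff nth)
        then show ?thesis using u by (simp add: grid_step_def)
      qed
      show "u (x + (\<lfloor>real N * t\<rfloor> / real N) *\<^sub>R axis i 1) = u (x + t *\<^sub>R axis i 1)" for t
        using u unfolding below[symmetric] by (simp add: grid_step_def)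
      show "continuous_on UNIV (\<lambda>t. partial_deriv i \<phi> (x + t *\<^sub>R axis i 1))"
        by (intro continuous_on_compose2[OF D_cont] continuous_intros) auto
    qed (rule test_function_deriv[OF \<phi>])
    then show "(\<integral>t. u (x + t *\<^sub>R axis i 1) * partial_deriv i \<phi> (x + t *\<^sub>R axis i 1) \<partial>lborel)
      = (\<integral>t. u (x + t *\<^sub>R axis i 1) * (real N * \<phi> (face_above N i (x + t *\<^sub>R axis i 1)))
          - u (x + t *\<^sub>R axis i 1) * (real N * \<phi> (face_below N i (x + t *\<^sub>R axis i 1))) \<partial>lborel)"
      unfolding below above by (simp add: algebra_simps)
  qed
  also have "\<dots> = ?A - ?B"
    using int by (rule Bochner_Integration.integral_diff)
  finally show ?thesis .
qed


text \<open>
  The Euclidean norm is at most the sum of the absolute values of the components, and each of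
  these is at most the sum of two measures, which are countably additive.
\<close>

lemma total_variation_le_components:
  fixes \<mu> :: "(real ^ 'n) set \<Rightarrow> real ^ 'n"
  assumes P: "\<And>i. finite_measure (P i)" "\<And>i. sets (P i) = sets borel"
    and Q: "\<And>i. finite_measure (Q i)" "\<And>i. sets (Q i) = sets borel"
    and \<mu>: "\<And>A i. A \<in> sets borel \<Longrightarrow> \<mu> A $ i = measure (P i) A - measure (Q i) A"
  shows "total_variation \<mu> UNIV \<le> (\<Sum>i\<in>UNIV. emeasure (P i) UNIV + emeasure (Q i) UNIV)"
  unfolding total_variation_def
proof (rule SUP_least)
  fix A :: "nat \<Rightarrow> (real ^ 'n) set"
  assume "A \<in> {A. range A \<subseteq> sets borel \<and> disjoint_family A \<and> (\<Union>k. A k) = UNIV}"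
  then have A: "range A \<subseteq> sets borel" "disjoint_family A" "(\<Union>k. A k) = UNIV"
    by auto
  have em: "ennreal (measure (P i) B) = emeasure (P i) B" "ennreal (measure (Q i) B) = emeasure (Q i) B" for i B
    using finite_measure.emeasure_eq_measure[OF P(1)] finite_measure.emeasure_eq_measure[OF Q(1)] by auto
  have "ennreal (norm (\<mu> (A k))) \<le> (\<Sum>i\<in>UNIV. emeasure (P i) (A k) + emeasure (Q i) (A k))" for k
  proof -
    have "norm (\<mu> (A k)) \<le> (\<Sum>i\<in>UNIV. \<bar>\<mu> (A k) $ i\<bar>)"
      by (rule norm_le_l1_cart)
    also have "\<dots> \<le> (\<Sum>i\<in>UNIV. measure (P i) (A k) + measure (Q i) (A k))"
    proof (rule sum_mono)
      fix i
      have "A k \<in> sets borel" using A(1) by auto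
      then show "\<bar>\<mu> (A k) $ i\<bar> \<le> measure (P i) (A k) + measure (Q i) (A k)"
        unfolding \<mu>[OF \<open>A k \<in> sets borel\<close>]
        using measure_nonneg[of "P i" "A k"] measure_nonneg[of "Q i" "A k"] by linarith
    qed
    finally have "ennreal (norm (\<mu> (A k))) \<le> ennreal (\<Sum>i\<in>UNIV. measure (P i) (A k) + measure (Q i) (A k))"
      by (rule ennreal_leI)
    also have "\<dots> = (\<Sum>i\<in>UNIV. emeasure (P i) (A k) + emeasure (Q i) (A k))"
      by (subst sum_ennreal[symmetric]) (auto simp: em ennreal_plus)
    finally show ?thesis .
  qed
  then have "(\<Sum>k. ennreal (norm (\<mu> (A k)))) \<le> (\<Sum>k. \<Sum>i\<in>UNIV. emeasure (P i) (A k) + emeasure (Q i) (A k))"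
    by (intro suminf_le summableI) 
  also have "\<dots> = (\<Sum>i\<in>UNIV. (\<Sum>k. emeasure (P i) (A k)) + (\<Sum>k. emeasure (Q i) (A k)))"
    by (subst suminf_sum) (auto simp: suminf_add[symmetric] intro!: summableI)
  also have "\<dots> = (\<Sum>i\<in>UNIV. emeasure (P i) UNIV + emeasure (Q i) UNIV)"
    using A P(2) Q(2) by (simp add: suminf_emeasure)
  finally show "(\<Sum>k. ennreal (norm (\<mu> (A k)))) \<le> (\<Sum>i\<in>UNIV. emeasure (P i) UNIV + emeasure (Q i) UNIV)" .
qed

lemma total_variation_cong:
  assumes "\<And>A. A \<in> sets borel \<Longrightarrow> \<mu> A = \<nu> A"
  shows "total_variation \<mu> S = total_variation \<nu> S"
  unfolding total_variation_def
proof (rule SUP_cong[OF refl])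
  fix A :: "nat \<Rightarrow> (real ^ 'a) set"
  assume "A \<in> {A. range A \<subseteq> sets borel \<and> disjoint_family A \<and> (\<Union>k. A k) = S}"
  then have "\<mu> (A k) = \<nu> (A k)" for k
    using assms by blast
  then show "(\<Sum>k. ennreal (norm (\<mu> (A k)))) = (\<Sum>k. ennreal (norm (\<nu> (A k))))"
    by simp
qed

text \<open>
  For each axis, the images of the measure with density \<open>N * u\<close> under the projections
  to the lower and to the upper faces have mass \<open>N * (\<integral>x. u x
  \<partial>lborel)\<close> each; their difference is the corresponding component of the gradient.
  The representative \<open>w\<close> allows for indicators of closed cells, which agree with
  half-open ones up to the faces.
\<close>

lemma grid_step_bv_norm:
  fixes u w :: "real ^ 'n \<Rightarrow> real"
  assumes N: "N > 0" and u: "grid_step N u"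
    and w: "w \<in> borel_measurable borel" "AE x in lborel. w x = u x"
  shows "w \<in> BV_cube" and "bv_norm w \<le> ennreal ((1 + 2 * real CARD('n) * real N) * (\<integral>x. u x \<partial>lborel))"
proof -
  define m where "m = (\<integral>x. u x \<partial>lborel)"
  have int_u: "integrable lborel u" and nonneg: "\<And>x. 0 \<le> u x"
    using u by (auto simp: grid_step_def)
  have [measurable]: "u \<in> borel_measurable borel" "w \<in> borel_measurable borel"
    using int_u w by (auto dest: borel_measurable_integrable)
  have nn_u: "(\<integral>\<^sup>+x. ennreal (u x) \<partial>lborel) = ennreal m"
    unfolding m_def by (rule nn_integral_eq_integral[OF int_u]) (simp add: nonneg)
  have AE_w: "AE x in lebesgue. w x = u x"
    using w(2) by (rule AE_completion)
  \<comment> \<open>by \<open>grid_step_gradient\<close>, these measures for \<open>S = face_below N i\<close> and \<open>S = face_above N i\<close> form the gradient\<close>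
  define face where "face S = distr (density lborel (\<lambda>x. ennreal (real N * u x))) borel S"
    for S :: "real ^ 'n \<Rightarrow> real ^ 'n"
  have sets_face: "sets (face S) = sets borel" for S
    by (simp add: face_def)
  have mass: "emeasure (face S) UNIV = ennreal (real N * m)" if [measurable]: "S \<in> borel \<rightarrow>\<^sub>M borel" for S
  proof -
    have "emeasure (face S) UNIV = (\<integral>\<^sup>+x. ennreal (real N) * ennreal (u x) \<partial>lborel)"
      by (simp add: face_def emeasure_distr emeasure_density ennreal_mult nonneg)
    also have "\<dots> = ennreal (real N) * ennreal m"
      by (simp add: nn_integral_cmult nn_u)
    finally show ?thesis
      by (simp add: ennreal_mult m_def nonneg integral_nonneg_AE)
  qed
  have fin: "finite_measure (face S)" if "S \<in> borel \<rightarrow>\<^sub>M borel" for S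
    by (rule finite_measureI) (use mass[OF that] in \<open>simp add: sets_eq_imp_space_eq[OF sets_face]\<close>)
  have int_face: "(\<integral>x. \<phi> x \<partial>face S) = (\<integral>x. u x * (real N * \<phi> (S x)) \<partial>lborel)"
    if [measurable]: "S \<in> borel \<rightarrow>\<^sub>M borel" "\<phi> \<in> borel_measurable borel" for S and \<phi> :: "real ^ 'n \<Rightarrow> real"
    unfolding face_def
    by (simp add: integral_distr integral_density nonneg mult.assoc mult.left_commute)
  define \<mu> where "\<mu> A = (\<chi> i. measure (face (face_below N i)) A - measure (face (face_above N i)) A)" for A
  have grad: "has_distr_gradient w \<mu>"
    unfolding has_distr_gradient_def
  proof (intro allI exI conjI ballI impI)
    fix i :: 'n and \<phi> :: "real ^ 'n \<Rightarrow> real" assume \<phi>: "test_function \<phi>"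
    note [measurable] = borel_measurable_continuous_onI[OF test_function_continuous[OF \<phi>]]
       borel_measurable_continuous_onI[OF test_function_deriv(1)[OF \<phi>]]
    have "(\<integral>x. w x * partial_deriv i \<phi> x \<partial>lebesgue) = (\<integral>x. w x * partial_deriv i \<phi> x \<partial>lborel)"
      by (rule integral_completion) simp
    also have "\<dots> = (\<integral>x. u x * partial_deriv i \<phi> x \<partial>lborel)"
      by (rule integral_cong_AE) (use w(2) in auto)
    finally show "(\<integral>x. w x * partial_deriv i \<phi> x \<partial>lebesgue)
      = - ((\<integral>x. \<phi> x \<partial>face (face_below N i)) - (\<integral>x. \<phi> x \<partial>face (face_above N i)))"
      unfolding grid_step_gradient[OF N u \<phi>] by (simp add: int_face)
  qed (auto simp: sets_face \<mu>_def intro!: fin)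
  have int_w: "integrable lebesgue w"
  proof (subst integrable_completion)
    show "integrable lborel w"
      using int_u w by (subst integrable_cong_AE[of w _ u]) auto
  qed simp
  have "AE x in lebesgue. x \<notin> unit_cube \<longrightarrow> w x = 0"
    using AE_w
  proof eventually_elim
    case (elim x)
    then show ?case
      using u half_open_cube_subset by (auto simp: grid_step_def)
  qed
  then show "w \<in> BV_cube"
    using int_w grad by (auto simp: BV_cube_def BV_def)
  have "has_distr_gradient w (distr_gradient w)"
    unfolding distr_gradient_def using someI[of "has_distr_gradient w", OF grad] .
  then have "total_variation (distr_gradient w) UNIV = total_variation \<mu> UNIV"
    using grad by (intro total_variation_cong has_distr_gradient_unique)
  also have "\<dots> \<le> (\<Sum>i\<in>UNIV. emeasure (face (face_below N i)) UNIV + emeasure (face (face_above N i)) UNIV)"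
    by (rule total_variation_le_components) (auto simp: sets_face \<mu>_def intro!: fin)
  also have "\<dots> = ennreal (2 * real CARD('n) * real N * m)"
    by (simp add: mass m_def integral_nonneg_AE nonneg ennreal_plus[symmetric] ennreal_of_nat_eq_real_of_nat
        ennreal_mult[symmetric] algebra_simps del: ennreal_plus)
  finally have TV: "total_variation (distr_gradient w) UNIV \<le> ennreal (2 * real CARD('n) * real N * m)" .
  have "(\<integral>\<^sup>+x. ennreal \<bar>w x\<bar> \<partial>lebesgue) = (\<integral>\<^sup>+x. ennreal (u x) \<partial>lebesgue)"
    using AE_w by (intro nn_integral_cong_AE) (auto simp: nonneg)
  also have "\<dots> = ennreal m"
    using nn_u by (simp add: nn_integral_completion)
  finally have "bv_norm w \<le> ennreal m + ennreal (2 * real CARD('n) * real N * m)"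
    unfolding bv_norm_def using TV by (intro add_mono) auto
  also have "\<dots> = ennreal ((1 + 2 * real CARD('n) * real N) * m)"
    by (subst ennreal_plus[symmetric]) (auto simp: m_def integral_nonneg_AE nonneg algebra_simps)
  finally show "bv_norm w \<le> ennreal ((1 + 2 * real CARD('n) * real N) * (\<integral>x. u x \<partial>lborel))"
    unfolding m_def .
qed

section \<open>Strong charges on unions of grid cells\<close>

definition grid :: "nat \<Rightarrow> ('n \<Rightarrow> nat) set"
  where "grid N = {k. \<forall>i. k i < N}"

definition lower_corner :: "nat \<Rightarrow> ('n \<Rightarrow> nat) \<Rightarrow> real ^ 'n"
  where "lower_corner N k = (\<chi> i. real (k i) / real N)"

definition upper_corner :: "nat \<Rightarrow> ('n \<Rightarrow> nat) \<Rightarrow> real ^ 'n"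
  where "upper_corner N k = (\<chi> i. real (Suc (k i)) / real N)"

definition cell :: "nat \<Rightarrow> ('n \<Rightarrow> nat) \<Rightarrow> (real ^ 'n) set"
  where "cell N k = cbox (lower_corner N k) (upper_corner N k)"

lemma grid_eq_PiE: "grid N = (\<Pi>\<^sub>E i\<in>UNIV. {..<N})"
  by (auto simp: grid_def PiE_def extensional_def)

lemma finite_grid [simp]: "finite (grid N :: ('n::finite \<Rightarrow> nat) set)"
  unfolding grid_eq_PiE by (rule finite_PiE) auto

lemma card_grid: "card (grid N :: ('n::finite \<Rightarrow> nat) set) = N ^ CARD('n)"
  unfolding grid_eq_PiE by (simp add: card_PiE)

lemma mem_cell: "x \<in> cell N k \<longleftrightarrow> (\<forall>i. real (k i) / real N \<le> x $ i \<and> x $ i \<le> real (Suc (k i)) / real N)"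
  by (simp add: cell_def lower_corner_def upper_corner_def mem_box_cart)

lemma cell_subset:
  assumes "k \<in> grid N"
  shows "cell N k \<subseteq> unit_cube"
proof
  fix x assume x: "x \<in> cell N k"
  have "0 \<le> x $ i \<and> x $ i \<le> 1" for i
  proof -
    have "k i < N" using assms by (simp add: grid_def)
    then have "real (Suc (k i)) / real N \<le> 1" by (simp add: field_simps)
    moreover have "0 \<le> real (k i) / real N" by simp
    ultimately show ?thesis using x unfolding mem_cell by (meson order_trans)
  qed
  then show "x \<in> unit_cube" by (simp add: mem_box_cart)
qed

lemma rectangle_cell:
  assumes "k \<in> grid N"
  shows "rectangle (lower_corner N k) (upper_corner N k)"
proof -
  have "N > 0" using assms by (auto simp: grid_def)
  then show ?thesis
    using cell_subset[OF assms]
    by (auto simp: rectangle_def cell_def lower_corner_def upper_corner_def divide_strict_right_mono)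
qed

lemma figure_cells: "S \<subseteq> grid N \<Longrightarrow> figure (\<Union>k\<in>S. cell N k)" for S :: "('n::finite \<Rightarrow> nat) set"
  unfolding figure_def
  by (intro exI[of _ "cell N ` S"]) (auto simp: cell_def finite_subset[OF _ finite_grid] intro: rectangle_cell)

lemma negligible_coordinate_hyperplane: "negligible {x :: real ^ 'n. x $ i = a}"
  using negligible_standard_hyperplane[of "axis i (1 :: real)" a] by (simp add: inner_axis)

text \<open>
  If \<open>k i < l i\<close>, then every common point of the two closed cells has
  \<open>i\<close>-th coordinate \<open>l i / N\<close>.
\<close>

lemma cells_almost_disjoint:
  fixes k l :: "'n::finite \<Rightarrow> nat"
  assumes N: "N > 0" and "k \<noteq> l"
  shows "negligible (cell N k \<inter> cell N l)"
proof -
  have *: "negligible (cell N k \<inter> cell N l)" if "k i < l i" for i and k l :: "'n \<Rightarrow> nat"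
  proof (rule negligible_subset[OF negligible_coordinate_hyperplane])
    show "cell N k \<inter> cell N l \<subseteq> {x. x $ i = real (l i) / real N}"
    proof (intro subsetI CollectI)
      fix x assume "x \<in> cell N k \<inter> cell N l"
      then have "x $ i \<le> real (Suc (k i)) / real N" "real (l i) / real N \<le> x $ i"
        by (auto simp: mem_cell)
      moreover have "real (Suc (k i)) / real N \<le> real (l i) / real N"
        using that by (intro divide_right_mono) auto
      ultimately show "x $ i = real (l i) / real N" by linarith
    qed
  qed
  obtain i where "k i \<noteq> l i" using \<open>k \<noteq> l\<close> by blast
  then show ?thesis
    using *[of k i l] *[of l i k] by (metis Int_commute linorder_neqE_nat)
qed

lemma figure_increment_cells:
  fixes S :: "('n::finite \<Rightarrow> nat) set"
  assumes D: "has_figure_increment f D" and S: "S \<subseteq> grid N"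
  shows "D (\<Union>k\<in>S. cell N k) = (\<Sum>k\<in>S. rect_increment f (lower_corner N k) (upper_corner N k))"
proof -
  have add: "D (F \<union> G) = D F + D G" if "figure F" "figure G" "negligible (F \<inter> G)" for F G
    using D that by (simp add: has_figure_increment_def)
  have "finite S" using S finite_grid finite_subset by blast
  then show ?thesis using S
  proof (induction S)
    case empty
    have "figure {}" by (auto simp: figure_def)
    from add[OF this this] show ?case by simp
  next
    case (insert k S)
    then have k: "k \<in> grid N" and "N > 0" by (auto simp: grid_def)
    have "negligible (cell N k \<inter> (\<Union>l\<in>S. cell N l))"
      unfolding Int_UN_distrib
    proof (rule negligible_Union)
      show "negligible T" if "T \<in> (\<lambda>l. cell N k \<inter> cell N l) ` S" for T
        using that insert \<open>N > 0\<close> by (auto intro!: cells_almost_disjoint)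
    qed (use insert in simp)
    moreover have "figure (cell N k)"
      using figure_cells[of "{k}" N] k by simp
    ultimately have "D (cell N k \<union> (\<Union>l\<in>S. cell N l)) = D (cell N k) + D (\<Union>l\<in>S. cell N l)"
      using insert.prems by (intro add figure_cells) auto
    moreover have "D (cell N k) = rect_increment f (lower_corner N k) (upper_corner N k)"
      using D rectangle_cell[OF k] by (simp add: has_figure_increment_def cell_def)
    ultimately show ?case
      using insert by simp
  qed
qed

text \<open>
  Off the grid hyperplanes, lying in a closed cell and lying in the half-open cell of the same
  index are equivalent.
\<close>

lemma AE_off_grid:
  fixes N :: nat
  shows "AE x :: real ^ 'n in lborel. \<forall>i. \<forall>m::nat. x $ i \<noteq> real m / real N"
proof -
  have "AE x :: real ^ 'n in lborel. x $ i \<noteq> a" for i a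
  proof (rule AE_I')
    have "{x :: real ^ 'n. x $ i = a} \<in> null_sets lebesgue"
      using negligible_coordinate_hyperplane by (simp add: negligible_iff_null_sets)
    moreover have "{x :: real ^ 'n. x $ i = a} \<in> sets lborel"
      by measurable
    ultimately show "{x :: real ^ 'n. x $ i = a} \<in> null_sets lborel"
      by (simp add: null_sets_completion_iff)
  qed auto
  then have "AE x :: real ^ 'n in lborel. \<forall>m::nat. x $ i \<noteq> real m / real N" for i
    by (simp add: AE_all_countable)
  then show ?thesis
    by (rule eventually_all_finite)
qed

text \<open>
  The bound is crude, because faces between neighbouring cells of the union are counted as well;
  its order \<open>N\<close> is the one that matters.
\<close>

lemma cells_bv_norm:
  fixes S :: "('n::finite \<Rightarrow> nat) set"
  assumes N: "N > 0" and S: "S \<subseteq> grid N" and c: "c \<ge> 0"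
  defines "w \<equiv> (\<lambda>x. c * indicat_real (\<Union>k\<in>S. cell N k) x)"
  shows "w \<in> BV_cube" and "bv_norm w \<le> ennreal ((1 + 2 * real CARD('n) * real N) * c)"
proof -
  \<comment> \<open>the union of the half-open cells with index in \<open>S\<close>\<close>
  define H :: "(real ^ 'n) set" where "H = {x. \<exists>k\<in>S. \<forall>i. \<lfloor>real N * x $ i\<rfloor> = int (k i)}"
  have fin: "finite S" using S finite_grid finite_subset by blast
  have [measurable]: "H \<in> sets borel"
  proof -
    have "H = (\<Union>k\<in>S. \<Inter>i. {x. \<lfloor>real N * x $ i\<rfloor> = int (k i)})"
      by (auto simp: H_def)
    moreover have "{x :: real ^ 'n. \<lfloor>real N * x $ i\<rfloor> = int m} \<in> sets borel" for i m
      by measurable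
    ultimately show ?thesis
      using fin by (simp add: sets.finite_UN sets.finite_INT)
  qed
  have H_sub: "H \<subseteq> half_open_cube"
  proof
    fix x assume "x \<in> H"
    then obtain k where k: "k \<in> S" "\<And>i. \<lfloor>real N * x $ i\<rfloor> = int (k i)" by (auto simp: H_def)
    have "0 \<le> x $ i \<and> x $ i < 1" for i
    proof -
      have "k i < N" using k(1) S by (auto simp: grid_def)
      then have "real (Suc (k i)) / real N \<le> 1" by (simp add: field_simps)
      moreover have "0 \<le> real (k i) / real N" by simp
      moreover have "real (k i) / real N \<le> x $ i \<and> x $ i < real (Suc (k i)) / real N"
        using k(2)[of i] mem_cell_iff_floor[OF N] by simp
      ultimately show ?thesis by linarith
    qed
    then show "x \<in> half_open_cube" by (simp add: half_open_cube_def)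
  qed
  have emH: "emeasure lborel H \<le> 1"
  proof -
    have "emeasure lborel H \<le> emeasure lborel (unit_cube :: (real ^ 'n) set)"
      using H_sub half_open_cube_subset by (intro emeasure_mono) auto
    also have "\<dots> = 1"
    proof -
      have "(\<Prod>b\<in>Basis. (1 - 0 :: real ^ 'n) \<bullet> b) = 1"
        by (rule prod.neutral) (auto simp: Basis_vec_def inner_axis)
      then show ?thesis
        by (subst emeasure_lborel_cbox) (auto simp: Basis_vec_def inner_axis)
    qed
    finally show ?thesis .
  qed
  have int_H: "integrable lborel (indicat_real H)"
    using emH by (simp add: integrable_indicator_iff order_le_less_trans[of _ 1])
  define u where "u x = c * indicat_real H x" for x
  have u: "grid_step N u"
    unfolding grid_step_def
  proof (intro conjI allI impI)
    show "0 \<le> u x" for x using c by (simp add: u_def)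
    show "u x = 0" if "x \<notin> half_open_cube" for x
      using that H_sub by (auto simp: u_def indicator_def)
    show "integrable lborel u"
      unfolding u_def using int_H by simp
    fix i :: 'n and x
    have "\<lfloor>real N * face_below N i x $ j\<rfloor> = \<lfloor>real N * x $ j\<rfloor>" for j
      using N by (simp add: face_nth)
    then show "u (face_below N i x) = u x"
      by (simp add: u_def indicator_def H_def)
  qed
  have [measurable]: "(\<Union>k\<in>S. cell N k) \<in> sets borel"
    using fin by (intro sets.finite_UN) (auto simp: cell_def)
  have w: "w \<in> borel_measurable borel"
    unfolding w_def by measurable
  have AE: "AE x in lborel. w x = u x"
    using AE_off_grid[of N]
  proof eventually_elim
    case (elim x)
    have "x \<in> cell N k \<longleftrightarrow> (\<forall>i. \<lfloor>real N * x $ i\<rfloor> = int (k i))" for k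
    proof -
      have "real (k i) / real N \<le> x $ i \<and> x $ i \<le> real (Suc (k i)) / real N \<longleftrightarrow> \<lfloor>real N * x $ i\<rfloor> = int (k i)" for i
        using elim[THEN spec[of _ i], THEN spec[of _ "Suc (k i)"]] mem_cell_iff_floor[OF N, of "x $ i" "k i"]
        by (auto simp del: of_nat_Suc)
      then show ?thesis unfolding mem_cell by simp
    qed
    then show ?case
      by (simp add: w_def u_def indicator_def H_def)
  qed
  show "w \<in> BV_cube"
    using grid_step_bv_norm(1)[OF N u w AE] .
  have "(\<integral>x. u x \<partial>lborel) = c * measure lborel H"
    by (simp add: u_def)
  also have "\<dots> \<le> c * 1"
    using emH c by (intro mult_left_mono) (auto simp: measure_def enn2real_leI)
  finally have "(1 + 2 * real CARD('n) * real N) * (\<integral>x. u x \<partial>lborel) \<le> (1 + 2 * real CARD('n) * real N) * c"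
    by (intro mult_left_mono) auto
  with grid_step_bv_norm(2)[OF N u w AE]
  show "bv_norm w \<le> ennreal ((1 + 2 * real CARD('n) * real N) * c)"
    using ennreal_leI order_trans by blast
qed

lemma BV_set_cells:
  fixes S :: "('n::finite \<Rightarrow> nat) set"
  assumes N: "N > 0" and S: "S \<subseteq> grid N"
  shows "BV_set (\<Union>k\<in>S. cell N k)" and "indicat_real (\<Union>k\<in>S. cell N k) \<in> BV_cube"
proof -
  show *: "indicat_real (\<Union>k\<in>S. cell N k) \<in> BV_cube"
    using cells_bv_norm(1)[OF N S, of 1] by simp
  have fin: "finite S" using S finite_grid finite_subset by blast
  have "(\<Union>k\<in>S. cell N k) \<in> sets lebesgue"
    using fin by (intro sets.finite_UN) (auto simp: cell_def)
  then show "BV_set (\<Union>k\<in>S. cell N k)"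
    using * S cell_subset unfolding BV_set_def BV_cube_def by blast
qed

text \<open>
  The cube has finite measure and \<open>y \<le> 1 + y ^ d\<close> for \<open>y \<ge> 0\<close>.
\<close>

lemma Ld_cube_integrable:
  assumes "f \<in> Ld_cube"
  shows "set_integrable lebesgue unit_cube f"
  unfolding set_integrable_def
proof (rule Bochner_Integration.integrable_bound)
  show "integrable lebesgue (\<lambda>x. indicat_real unit_cube x + indicat_real unit_cube x *\<^sub>R (\<bar>f x\<bar> ^ CARD('a)))"
    using assms unfolding Ld_cube_def set_integrable_def
    by (intro Bochner_Integration.integrable_add) (auto intro!: integrable_real_indicator emeasure_lborel_cbox_finite[unfolded infinity_ennreal_def])
  show "(\<lambda>x. indicat_real unit_cube x *\<^sub>R f x) \<in> borel_measurable lebesgue"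
    using assms unfolding Ld_cube_def set_borel_measurable_def by simp
  have "y \<le> 1 + y ^ CARD('a)" if "0 \<le> y" for y :: real
  proof (cases "y \<le> 1")
    case False
    then have "y \<le> y ^ CARD('a)" by (intro self_le_power) auto
    then show ?thesis by simp
  qed (use that in \<open>simp add: add_increasing2\<close>)
  then show "AE x in lebesgue. norm (indicat_real unit_cube x *\<^sub>R f x)
      \<le> norm (indicat_real unit_cube x + indicat_real unit_cube x *\<^sub>R (\<bar>f x\<bar> ^ CARD('a)))"
    by (intro AE_I2) (auto simp: indicator_def)
qed

text \<open>
  Let \<open>g\<close> represent a functional within distance \<open>\<epsilon>\<close> of the one
  that defines the charge, let \<open>B\<close> be the union of the cells in \<open>S\<close>, and
  let \<open>r = 1 + 2 * d * N\<close>. By \<open>cells_bv_norm\<close>, the function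
  \<open>indicat_real B / r\<close> lies in the unit ball of \<open>BV\<close>, and integrating
  \<open>g\<close> against it gives at most \<open>C / r\<close>, where \<open>C\<close> is the
  \<open>L\<close>-one norm of \<open>g\<close>. Hence the absolute value of the charge of
  \<open>B\<close>, divided by \<open>r\<close>, is at most \<open>\<epsilon> + C / r\<close>.
  What matters is that \<open>C\<close> depends neither on \<open>N\<close> nor on
  \<open>S\<close>.
\<close>

lemma strong_charge_grid_bound:
  fixes f :: "real ^ 'n \<Rightarrow> real"
  assumes f: "strongly_chargeable f" and \<epsilon>: "\<epsilon> > 0"
  obtains C where "\<And>N S. N > 0 \<Longrightarrow> S \<subseteq> grid N \<Longrightarrow>
    \<bar>\<Sum>k\<in>S. rect_increment f (lower_corner N k) (upper_corner N k)\<bar> \<le> \<epsilon> * (1 + 2 * real CARD('n) * real N) + C"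
proof -
  obtain D \<nu> where D: "has_figure_increment f D" and "strong_charge \<nu>" and \<nu>D: "\<And>F. figure F \<Longrightarrow> \<nu> F = D F"
    using f by (auto simp: strongly_chargeable_def)
  then obtain \<alpha> where \<alpha>: "\<alpha> \<in> SCH" and \<nu>: "\<And>B. BV_set B \<Longrightarrow> \<nu> B = \<alpha> (indicat_real B)"
    by (auto simp: strong_charge_def)
  obtain g where g: "g \<in> Ld_cube" and dual: "bv_dual_norm (\<lambda>u. \<alpha> u - T_functional g u) < ennreal \<epsilon>"
    using \<alpha> \<epsilon> by (auto simp: SCH_def)
  have int_g: "integrable lebesgue (\<lambda>x. indicat_real unit_cube x *\<^sub>R g x)"
    using Ld_cube_integrable[OF g] by (simp add: set_integrable_def)
  define C where "C = (\<integral>x. norm (indicat_real unit_cube x *\<^sub>R g x) \<partial>lebesgue)"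
  show thesis
  proof
    fix N :: nat and S :: "('n \<Rightarrow> nat) set" assume N: "N > 0" and S: "S \<subseteq> grid N"
    let ?B = "\<Union>k\<in>S. cell N k" and ?sum = "\<Sum>k\<in>S. rect_increment f (lower_corner N k) (upper_corner N k)"
    define r where "r = 1 + 2 * real CARD('n) * real N"
    define w where "w x = (1 / r) * indicat_real ?B x" for x
    have r: "r > 0" by (simp add: r_def add_pos_nonneg)
    have w: "w \<in> BV_cube" "bv_norm w \<le> 1"
      using cells_bv_norm[OF N S, of "1 / r"] r unfolding w_def[abs_def] r_def[symmetric] by auto
    have "\<alpha> w = (1 / r) * \<alpha> (indicat_real ?B)"
      using \<alpha> BV_set_cells(2)[OF N S] unfolding w_def[abs_def] SCH_def BV_dual_def by blast
    also have "\<alpha> (indicat_real ?B) = ?sum"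
      using \<nu>[OF BV_set_cells(1)[OF N S]] \<nu>D[OF figure_cells[OF S]] figure_increment_cells[OF D S] by simp
    finally have \<alpha>w: "\<alpha> w = (1 / r) * ?sum" .
    have "ennreal \<bar>\<alpha> w - T_functional g w\<bar> \<le> bv_dual_norm (\<lambda>u. \<alpha> u - T_functional g u)"
      unfolding bv_dual_norm_def by (rule SUP_upper) (use w in simp)
    also note dual
    finally have 1: "\<bar>\<alpha> w - T_functional g w\<bar> \<le> \<epsilon>"
      using \<epsilon> by (simp add: ennreal_less_iff)
    have "\<bar>T_functional g w\<bar> \<le> (1 / r) * C"
    proof -
      have "norm (T_functional g w) \<le> (\<integral>x. (1 / r) * norm (indicat_real unit_cube x *\<^sub>R g x) \<partial>lebesgue)"
        unfolding T_functional_def set_lebesgue_integral_def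
      proof (rule Bochner_Integration.integral_norm_bound_integral)
        show "integrable lebesgue (\<lambda>x. (1 / r) * norm (indicat_real unit_cube x *\<^sub>R g x))"
          using int_g by (intro integrable_mult_right integrable_norm)
        have bound: "norm (indicat_real unit_cube x *\<^sub>R (g x * w x))
            \<le> (1 / r) * norm (indicat_real unit_cube x *\<^sub>R g x)" for x
        proof -
          have "\<bar>w x\<bar> \<le> 1 / r"
            using r by (simp add: w_def indicator_def)
          then have "\<bar>w x\<bar> * \<bar>g x\<bar> \<le> (1 / r) * \<bar>g x\<bar>"
            by (rule mult_right_mono) simp
          then show ?thesis
            by (simp add: indicator_def abs_mult mult.commute)
        qed
        then show "norm (indicat_real unit_cube x *\<^sub>R (g x * w x))
            \<le> (1 / r) * norm (indicat_real unit_cube x *\<^sub>R g x)" for x .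
        have "w \<in> borel_measurable lebesgue"
          using w(1) by (auto simp: BV_cube_def BV_def)
        then have "(\<lambda>x. (indicat_real unit_cube x *\<^sub>R g x) * w x) \<in> borel_measurable lebesgue"
          by (intro borel_measurable_times borel_measurable_integrable[OF int_g])
        then have "(\<lambda>x. indicat_real unit_cube x *\<^sub>R (g x * w x)) \<in> borel_measurable lebesgue"
          by (simp add: mult.assoc)
        then show "integrable lebesgue (\<lambda>x. indicat_real unit_cube x *\<^sub>R (g x * w x))"
        proof (rule Bochner_Integration.integrable_bound[rotated])
          show "integrable lebesgue (\<lambda>x. (1 / r) * norm (indicat_real unit_cube x *\<^sub>R g x))"
            using int_g by (intro integrable_mult_right integrable_norm)
          show "AE x in lebesgue. norm (indicat_real unit_cube x *\<^sub>R (g x * w x))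
              \<le> norm ((1 / r) * norm (indicat_real unit_cube x *\<^sub>R g x))"
            using order_trans[OF bound abs_ge_self] by (intro AE_I2) simp
        qed
      qed
      also have "\<dots> = (1 / r) * C"
        unfolding C_def by (rule integral_mult_right_zero)
      finally show ?thesis by simp
    qed
    with 1 have "(1 / r) * \<bar>?sum\<bar> \<le> \<epsilon> + (1 / r) * C"
      using r by (simp add: \<alpha>w abs_mult[symmetric])
    then show "\<bar>?sum\<bar> \<le> \<epsilon> * (1 + 2 * real CARD('n) * real N) + C"
      unfolding r_def[symmetric] using r by (simp add: field_simps)
  qed
qed

text \<open>
  The sum of absolute values is the increment over the cells where it is nonnegative, minus the
  increment over the others; the previous bound applies to both unions.
\<close>

lemma strongly_chargeable_imp_grid_variation_small:
  fixes f :: "real ^ 'n \<Rightarrow> real"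
  assumes f: "strongly_chargeable f"
  shows "(\<lambda>N. (\<Sum>k\<in>grid N. \<bar>rect_increment f (lower_corner N k) (upper_corner N k)\<bar>) / real N) \<longlonglongrightarrow> 0"
proof (rule LIMSEQ_I)
  fix e :: real assume e: "e > 0"
  let ?\<Delta> = "\<lambda>N k. rect_increment f (lower_corner N k) (upper_corner N k)"
  define d where "d = 1 + 2 * real CARD('n)"
  have d: "d > 0" by (simp add: d_def add_pos_nonneg)
  \<comment> \<open>the two applications of the bound then contribute \<open>2 * \<epsilon> * d = e / 2\<close>\<close>
  define \<epsilon> where "\<epsilon> = e / (4 * d)"
  have "\<epsilon> > 0" using e d by (simp add: \<epsilon>_def)
  from strong_charge_grid_bound[OF f this] obtain C where
    C: "\<And>N S. N > 0 \<Longrightarrow> S \<subseteq> grid N \<Longrightarrow> \<bar>\<Sum>k\<in>S. ?\<Delta> N k\<bar> \<le> \<epsilon> * (1 + 2 * real CARD('n) * real N) + C"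
    by blast
  obtain N0 :: nat where N0: "real N0 > 4 * \<bar>C\<bar> / e"
    using reals_Archimedean2 by blast
  show "\<exists>N0. \<forall>N\<ge>N0. norm ((\<Sum>k\<in>grid N. \<bar>?\<Delta> N k\<bar>) / real N - 0) < e"
  proof (intro exI[of _ "Suc N0"] allI impI)
    fix N assume "Suc N0 \<le> N"
    then have N: "N > 0" and "real N > 4 * \<bar>C\<bar> / e" using N0 by auto
    then have CN: "4 * \<bar>C\<bar> < e * real N" using e by (simp add: field_simps)
    define P where "P = {k \<in> grid N. 0 \<le> ?\<Delta> N k}"
    have P: "P \<subseteq> grid N" by (auto simp: P_def)
    have "(\<Sum>k\<in>grid N. \<bar>?\<Delta> N k\<bar>) = (\<Sum>k\<in>P. \<bar>?\<Delta> N k\<bar>) + (\<Sum>k\<in>grid N - P. \<bar>?\<Delta> N k\<bar>)"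
      using P by (simp add: sum.subset_diff add.commute)
    also have "(\<Sum>k\<in>P. \<bar>?\<Delta> N k\<bar>) = (\<Sum>k\<in>P. ?\<Delta> N k)"
      by (rule sum.cong) (auto simp: P_def)
    also have "(\<Sum>k\<in>grid N - P. \<bar>?\<Delta> N k\<bar>) = - (\<Sum>k\<in>grid N - P. ?\<Delta> N k)"
      unfolding sum_negf[symmetric] by (rule sum.cong) (auto simp: P_def)
    finally have "(\<Sum>k\<in>grid N. \<bar>?\<Delta> N k\<bar>) \<le> 2 * (\<epsilon> * (1 + 2 * real CARD('n) * real N) + C)"
      using C[OF N P] C[OF N, of "grid N - P"] by auto
    also have "\<dots> \<le> 2 * (\<epsilon> * (d * real N) + \<bar>C\<bar>)"
    proof -
      have "1 + 2 * real CARD('n) * real N \<le> d * real N"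
        using N by (simp add: d_def distrib_right)
      then show ?thesis
        using \<open>\<epsilon> > 0\<close> by (intro mult_left_mono add_mono) auto
    qed
    also have "\<dots> = e * real N / 2 + 2 * \<bar>C\<bar>"
      using d by (simp add: \<epsilon>_def field_simps)
    also have "\<dots> < e * real N"
      using CN by linarith
    finally show "norm ((\<Sum>k\<in>grid N. \<bar>?\<Delta> N k\<bar>) / real N - 0) < e"
      using N by (simp add: sum_nonneg field_simps)
  qed
qed

section \<open>Rectangle increments of product functions\<close>

definition corners :: "real ^ 'n \<Rightarrow> real ^ 'n \<Rightarrow> (real ^ 'n) set"
  where "corners a b = {c. \<forall>i. c $ i \<in> {a $ i, b $ i}}"

definition corner_sign :: "real ^ 'n \<Rightarrow> real ^ 'n \<Rightarrow> real"
  where "corner_sign a c = (- 1) ^ card {i. c $ i = a $ i}"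

lemma rect_increment_eq: "rect_increment f a b = (\<Sum>c\<in>corners a b. corner_sign a c * f c)"
  by (simp add: rect_increment_def corners_def corner_sign_def)

text \<open>
  Choosing a corner amounts to choosing one of the two endpoints in every coordinate, which is
  what expanding a product of two-term sums does.
\<close>

lemma corners_bij_PiE:
  "bij_betw (\<lambda>g. \<chi> i. g i) (\<Pi>\<^sub>E i\<in>UNIV. {a $ i, b $ i}) (corners a b)"
  by (rule bij_betw_byWitness[where f' = "\<lambda>c i. c $ i"]) (auto simp: corners_def PiE_def extensional_def)

lemma finite_corners: "finite (corners a b)"
  using bij_betw_finite[OF corners_bij_PiE[of a b]] by (simp add: finite_PiE)

lemma corners_subset:
  assumes "rectangle a b"
  shows "corners a b \<subseteq> unit_cube"
proof -
  have le: "a $ i \<le> b $ i" for i using assms by (simp add: rectangle_def less_imp_le)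
  have "corners a b \<subseteq> cbox a b"
  proof
    fix c assume "c \<in> corners a b"
    then have "c $ i = a $ i \<or> c $ i = b $ i" for i by (simp add: corners_def)
    with le have "a $ i \<le> c $ i \<and> c $ i \<le> b $ i" for i by (metis order_refl)
    then show "c \<in> cbox a b" by (simp add: mem_box_cart)
  qed
  then show ?thesis using assms by (auto simp: rectangle_def)
qed

lemma rect_increment_prod:
  fixes h :: "'n::finite \<Rightarrow> real \<Rightarrow> real"
  assumes "\<And>i. a $ i < b $ i"
  shows "rect_increment (\<lambda>x. \<Prod>i\<in>UNIV. h i (x $ i)) a b = (\<Prod>i\<in>UNIV. h i (b $ i) - h i (a $ i))"
proof -
  \<comment> \<open>the sign of a corner: one factor \<open>-1\<close> for each coordinate in which the lower endpoint is chosen\<close>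
  define e where "e i y = (if y = a $ i then -1 else 1 :: real)" for i y
  have "(\<Prod>i\<in>UNIV. h i (b $ i) - h i (a $ i)) = (\<Prod>i\<in>UNIV. \<Sum>y\<in>{a $ i, b $ i}. e i y * h i y)"
  proof (rule prod.cong[OF refl])
    fix i
    show "h i (b $ i) - h i (a $ i) = (\<Sum>y\<in>{a $ i, b $ i}. e i y * h i y)"
      using assms[of i] by (auto simp: e_def)
  qed
  also have "\<dots> = (\<Sum>g\<in>(\<Pi>\<^sub>E i\<in>UNIV. {a $ i, b $ i}). \<Prod>i\<in>UNIV. e i (g i) * h i (g i))"
    by (rule prod_sum_PiE) auto
  also have "\<dots> = (\<Sum>c\<in>corners a b. \<Prod>i\<in>UNIV. e i (c $ i) * h i (c $ i))"
    using sum.reindex_bij_betw[OF corners_bij_PiE[of a b], of "\<lambda>c. \<Prod>i\<in>UNIV. e i (c $ i) * h i (c $ i)"]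
    by simp
  also have "\<dots> = rect_increment (\<lambda>x. \<Prod>i\<in>UNIV. h i (x $ i)) a b"
    unfolding rect_increment_eq corner_sign_def
    by (simp add: prod.distrib e_def prod.If_cases)
  finally show ?thesis ..
qed

text \<open>
  By \<open>rect_increment_prod\<close>, used in both variables, the covariance of two increments
  is the product over the coordinates of the lengths of the overlaps of the two intervals. Two
  grid intervals of side \<open>1 / N\<close> coincide or have overlap of length \<open>0\<close>.
\<close>

lemma sheet_covariance_cells:
  fixes k l :: "'n::finite \<Rightarrow> nat"
  assumes k: "k \<in> grid N" and l: "l \<in> grid N"
  shows "rect_increment (\<lambda>s. rect_increment (\<lambda>t. \<Prod>i\<in>UNIV. min (s $ i) (t $ i))
      (lower_corner N l) (upper_corner N l)) (lower_corner N k) (upper_corner N k)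
    = (if k = l then 1 / real N ^ CARD('n) else 0)"
proof -
  have N: "N > 0" using k by (auto simp: grid_def)
  have lt: "lower_corner N m $ i < upper_corner N m $ i" for m :: "'n \<Rightarrow> nat" and i
    using N by (simp add: lower_corner_def upper_corner_def divide_strict_right_mono)
  let ?f = "\<lambda>i. (min (upper_corner N k $ i) (upper_corner N l $ i) - min (upper_corner N k $ i) (lower_corner N l $ i))
     - (min (lower_corner N k $ i) (upper_corner N l $ i) - min (lower_corner N k $ i) (lower_corner N l $ i))"
  have "?f i = (if k i = l i then 1 / real N else 0)" for i
  proof -
    have mono: "real m / real N \<le> real m' / real N" if "m \<le> m'" for m m' :: nat
      using that by (simp add: divide_right_mono)
    have disjoint: "(min b b' - min b a') - (min a b' - min a a') = 0"
      if "a \<le> b" "a' \<le> b'" "b \<le> a' \<or> b' \<le> a" for a b a' b' :: real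
      using that by (auto simp: min_def)
    show ?thesis
    proof (cases "k i = l i")
      case True
      then show ?thesis
        using mono[of "l i" "Suc (l i)"] N
        by (simp add: lower_corner_def upper_corner_def min_def field_simps)
    next
      case False
      then have "Suc (k i) \<le> l i \<or> Suc (l i) \<le> k i" by linarith
      then have "real (Suc (k i)) / real N \<le> real (l i) / real N \<or> real (Suc (l i)) / real N \<le> real (k i) / real N"
        using mono by blast
      then show ?thesis
        using False disjoint[OF mono[of "k i" "Suc (k i)"] mono[of "l i" "Suc (l i)"]]
        by (simp add: lower_corner_def upper_corner_def)
    qed
  qed
  then have "(\<Prod>i\<in>UNIV. ?f i) = (\<Prod>i\<in>UNIV. if k i = l i then 1 / real N else 0)"
    by (intro prod.cong) auto
  also have "\<dots> = (if k = l then 1 / real N ^ CARD('n) else 0)"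
  proof (cases "k = l")
    case False
    then obtain i where "k i \<noteq> l i" by blast
    then have "(\<Prod>i\<in>UNIV. if k i = l i then 1 / real N else 0) = 0"
      by (intro prod_zero) auto
    with False show ?thesis by simp
  qed (simp add: power_one_over)
  finally show ?thesis
    by (simp add: rect_increment_prod[where h = "\<lambda>i t. min (s $ i) t" for s] rect_increment_prod[where
        h = "\<lambda>i s. min s (upper_corner N l $ i) - min s (lower_corner N l $ i)"] lt)
qed

section \<open>Normalized increments of the Brownian sheet\<close>

text \<open>
  This inequality lets the bounded function \<open>1 - cos\<close> replace the absolute value: the
  mean of \<open>cos\<close> under a Gaussian law is its characteristic function, which is
  explicit.
\<close>

lemma one_minus_cos_le: "1 - cos x \<le> \<bar>x\<bar>" for x :: real
proof -
  have "1 - cos x = 2 * (sin (x / 2))\<^sup>2"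
    using cos_double_sin[of "x / 2"] by simp
  also have "\<dots> \<le> 2 * \<bar>sin (x / 2)\<bar>"
    using abs_sin_le_one[of "x / 2"] mult_right_le_one_le[of "\<bar>sin (x / 2)\<bar>" "\<bar>sin (x / 2)\<bar>"]
    by (simp add: power2_eq_square abs_mult[symmetric])
  also have "\<dots> \<le> 2 * \<bar>x / 2\<bar>"
    using abs_sin_x_le_abs_x[of "x / 2"] by (intro mult_left_mono) auto
  finally show ?thesis by simp
qed

lemma integral_cos_std_normal: "(\<integral>x. cos (t * x) \<partial>std_normal_distribution) = exp (- (t\<^sup>2) / 2)"
proof -
  interpret real_distribution std_normal_distribution
    by (rule real_dist_normal_dist)
  have "integrable std_normal_distribution (\<lambda>x. iexp (t * x))"
    by (rule integrable_iexp) auto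
  then have "(\<integral>x. Re (iexp (t * x)) \<partial>std_normal_distribution) = Re (char std_normal_distribution t)"
    unfolding char_def by (rule integral_Re)
  then show ?thesis
    by (simp add: char_std_normal_distribution Re_exp)
qed

lemma integral_double_sum:
  fixes f :: "'a \<Rightarrow> 'b \<Rightarrow> 'c \<Rightarrow> real"
  assumes "\<And>s t. s \<in> S \<Longrightarrow> t \<in> T \<Longrightarrow> integrable M (f s t)"
  shows "(\<integral>x. (\<Sum>s\<in>S. \<Sum>t\<in>T. f s t x) \<partial>M) = (\<Sum>s\<in>S. \<Sum>t\<in>T. \<integral>x. f s t x \<partial>M)"
proof -
  have "(\<integral>x. (\<Sum>s\<in>S. \<Sum>t\<in>T. f s t x) \<partial>M) = (\<Sum>s\<in>S. \<integral>x. (\<Sum>t\<in>T. f s t x) \<partial>M)"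
    using assms by (intro Bochner_Integration.integral_sum Bochner_Integration.integrable_sum)
  also have "\<dots> = (\<Sum>s\<in>S. \<Sum>t\<in>T. \<integral>x. f s t x \<partial>M)"
    using assms by (intro sum.cong refl Bochner_Integration.integral_sum)
  finally show ?thesis .
qed

context prob_space
begin

text \<open>
  Point masses are included as the case of variance \<open>0\<close>; the formula for the cosine
  is the real part of the characteristic function at \<open>1\<close>.
\<close>

lemma centered_gaussian_rv:
  assumes X: "gaussian_rv M X" and mean: "expectation X = 0"
  shows "integrable M X" "integrable M (\<lambda>\<omega>. (X \<omega>)\<^sup>2)"
    and "expectation (\<lambda>\<omega>. cos (X \<omega>)) = exp (- expectation (\<lambda>\<omega>. (X \<omega>)\<^sup>2) / 2)"
proof -
  have [measurable]: "X \<in> borel_measurable M"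
    using X by (simp add: gaussian_rv_def)
  have "integrable M X \<and> integrable M (\<lambda>\<omega>. (X \<omega>)\<^sup>2) \<and>
      expectation (\<lambda>\<omega>. cos (X \<omega>)) = exp (- expectation (\<lambda>\<omega>. (X \<omega>)\<^sup>2) / 2)"
    using X unfolding gaussian_rv_def
  proof (elim conjE disjE exE)
    fix m assume m: "AE \<omega> in M. X \<omega> = m"
    have "expectation X = expectation (\<lambda>_. m)"
      using m by (intro integral_cong_AE) auto
    with mean have "m = 0" by (simp add: prob_space)
    with m have ae: "AE \<omega> in M. X \<omega> = 0" by simp
    have "integrable M X"
      by (subst integrable_cong_AE[of _ _ "\<lambda>_. 0"]) (use ae in auto)
    moreover have "integrable M (\<lambda>\<omega>. (X \<omega>)\<^sup>2)"
      by (subst integrable_cong_AE[of _ _ "\<lambda>_. 0"]) (use ae in auto)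
    moreover have "expectation (\<lambda>\<omega>. (X \<omega>)\<^sup>2) = expectation (\<lambda>_. 0)"
      by (rule integral_cong_AE) (use ae in auto)
    moreover have "expectation (\<lambda>\<omega>. cos (X \<omega>)) = expectation (\<lambda>_. 1)"
      by (rule integral_cong_AE) (use ae in auto)
    ultimately show ?thesis by (simp add: prob_space)
  next
    fix m \<sigma> assume \<sigma>: "\<sigma> > 0" and D: "distributed M lborel X (\<lambda>x. ennreal (normal_density m \<sigma> x))"
    have "m = 0"
      using normal_distributed_expectation[OF \<sigma> D] mean by simp
    note D = D[unfolded this]
    have 1: "integrable M X"
      using distributed_integrable[OF D, of "\<lambda>x. x"] integrable_normal_moment[OF \<sigma>, of 0 1] by simp
    have 2: "integrable M (\<lambda>\<omega>. (X \<omega>)\<^sup>2)"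
      using distributed_integrable[OF D, of "\<lambda>x. x\<^sup>2"] integrable_normal_moment[OF \<sigma>, of 0 2] by simp
    have var: "expectation (\<lambda>\<omega>. (X \<omega>)\<^sup>2) = \<sigma>\<^sup>2"
      using normal_distributed_variance[OF \<sigma> D] mean by simp
    have Y: "distributed M lborel (\<lambda>\<omega>. X \<omega> / \<sigma>) std_normal_density"
      using D normal_standard_normal_convert[OF \<sigma>, of X 0] by simp
    have "expectation (\<lambda>\<omega>. cos (\<sigma> * (X \<omega> / \<sigma>))) = (\<integral>x. cos (\<sigma> * x) \<partial>distr M lborel (\<lambda>\<omega>. X \<omega> / \<sigma>))"
      by (subst integral_distr) auto
    also have "\<dots> = exp (- (\<sigma>\<^sup>2) / 2)"
      unfolding distributed_distr_eq_density[OF Y] by (rule integral_cos_std_normal)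
    finally show ?thesis
      using 1 2 var \<sigma> by simp
  qed
  then show "integrable M X" "integrable M (\<lambda>\<omega>. (X \<omega>)\<^sup>2)"
    "expectation (\<lambda>\<omega>. cos (X \<omega>)) = exp (- expectation (\<lambda>\<omega>. (X \<omega>)\<^sup>2) / 2)"
    by auto
qed

end

locale brownian_sheet_space = prob_space M for M :: "'w measure" +
  fixes W :: "real ^ 'n::finite \<Rightarrow> 'w \<Rightarrow> real"
  assumes sheet: "brownian_sheet M W"
begin

text \<open>
  Sums and differences of increments stay in this space, so that they are centered Gaussian along
  with the increments.
\<close>

definition gaussian_space :: "('w \<Rightarrow> real) set"
  where "gaussian_space = {X. \<exists>S c. finite S \<and> S \<subseteq> unit_cube \<and> X = (\<lambda>\<omega>. \<Sum>t\<in>S. c t * W t \<omega>)}"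

lemma gaussian_spaceI: "finite S \<Longrightarrow> S \<subseteq> unit_cube \<Longrightarrow> (\<lambda>\<omega>. \<Sum>t\<in>S. c t * W t \<omega>) \<in> gaussian_space"
  unfolding gaussian_space_def by blast

lemma gaussian_space_scale:
  assumes "X \<in> gaussian_space"
  shows "(\<lambda>\<omega>. a * X \<omega>) \<in> gaussian_space"
proof -
  obtain S c where S: "finite S" "S \<subseteq> unit_cube" "X = (\<lambda>\<omega>. \<Sum>t\<in>S. c t * W t \<omega>)"
    using assms by (auto simp: gaussian_space_def)
  have "(\<lambda>\<omega>. a * X \<omega>) = (\<lambda>\<omega>. \<Sum>t\<in>S. (a * c t) * W t \<omega>)"
    by (simp add: S(3) sum_distrib_left mult.assoc)
  then show ?thesis
    using gaussian_spaceI[OF S(1,2), of "\<lambda>t. a * c t"] by simp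
qed

lemma gaussian_space_add:
  assumes "X \<in> gaussian_space" "Y \<in> gaussian_space"
  shows "(\<lambda>\<omega>. X \<omega> + Y \<omega>) \<in> gaussian_space"
proof -
  obtain S c where S: "finite S" "S \<subseteq> unit_cube" "X = (\<lambda>\<omega>. \<Sum>t\<in>S. c t * W t \<omega>)"
    using assms(1) by (auto simp: gaussian_space_def)
  obtain T d where T: "finite T" "T \<subseteq> unit_cube" "Y = (\<lambda>\<omega>. \<Sum>t\<in>T. d t * W t \<omega>)"
    using assms(2) by (auto simp: gaussian_space_def)
  define e where "e t = (if t \<in> S then c t else 0) + (if t \<in> T then d t else 0)" for t
  have "(\<Sum>t\<in>S \<union> T. e t * W t \<omega>) = X \<omega> + Y \<omega>" for \<omega>
  proof -
    have "(\<Sum>t\<in>S \<union> T. (if t \<in> S then c t else 0) * W t \<omega>) = X \<omega>"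
      unfolding S(3) by (rule sum.mono_neutral_cong_right) (use S T in auto)
    moreover have "(\<Sum>t\<in>S \<union> T. (if t \<in> T then d t else 0) * W t \<omega>) = Y \<omega>"
      unfolding T(3) by (rule sum.mono_neutral_cong_right) (use S T in auto)
    ultimately show ?thesis
      by (simp add: e_def distrib_right sum.distrib)
  qed
  then show ?thesis
    using gaussian_spaceI[of "S \<union> T" e] S T by simp
qed

lemma gaussian_space_W: "t \<in> unit_cube \<Longrightarrow> W t \<in> gaussian_space"
  using gaussian_spaceI[of "{t}" "\<lambda>_. 1"] by simp

lemma gaussian_space_gaussian:
  assumes "X \<in> gaussian_space"
  shows "gaussian_rv M X" "expectation X = 0"
proof -
  have gauss: "gaussian_rv M X" if "X \<in> gaussian_space" for X
    using that sheet unfolding gaussian_space_def brownian_sheet_def gaussian_process_def by blast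
  then show "gaussian_rv M X" using assms .
  have mean: "expectation (W t) = 0" if "t \<in> unit_cube" for t
    using sheet that by (simp add: brownian_sheet_def)
  obtain S c where S: "finite S" "S \<subseteq> unit_cube" "X = (\<lambda>\<omega>. \<Sum>t\<in>S. c t * W t \<omega>)"
    using assms by (auto simp: gaussian_space_def)
  have "integrable M (W t)" if "t \<in> S" for t
    using that S gaussian_space_W gauss mean centered_gaussian_rv(1) by blast
  then have "expectation X = (\<Sum>t\<in>S. c t * expectation (W t))"
    unfolding S(3) by (subst Bochner_Integration.integral_sum) auto
  then show "expectation X = 0"
    using mean S by (simp add: subset_iff)
qed

lemma gaussian_space_measurable: "X \<in> gaussian_space \<Longrightarrow> X \<in> borel_measurable M"
  using gaussian_space_gaussian(1) by (auto simp: gaussian_rv_def)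

lemma gaussian_space_integrable_mult:
  assumes "X \<in> gaussian_space" "Y \<in> gaussian_space"
  shows "integrable M (\<lambda>\<omega>. X \<omega> * Y \<omega>)"
proof (rule Bochner_Integration.integrable_bound)
  show "integrable M (\<lambda>\<omega>. (X \<omega>)\<^sup>2 + (Y \<omega>)\<^sup>2)"
    using assms gaussian_space_gaussian centered_gaussian_rv(2) by (intro Bochner_Integration.integrable_add) blast+
  show "(\<lambda>\<omega>. X \<omega> * Y \<omega>) \<in> borel_measurable M"
    using assms by (intro borel_measurable_times gaussian_space_measurable)
  have "\<bar>x * y\<bar> \<le> x\<^sup>2 + y\<^sup>2" for x y :: real
  proof -
    have "2 * \<bar>x * y\<bar> \<le> x\<^sup>2 + y\<^sup>2"
      using sum_squares_bound[of "\<bar>x\<bar>" "\<bar>y\<bar>"] by (simp add: abs_mult mult.assoc)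
    then show ?thesis by linarith
  qed
  then show "AE \<omega> in M. norm (X \<omega> * Y \<omega>) \<le> norm ((X \<omega>)\<^sup>2 + (Y \<omega>)\<^sup>2)"
    by (intro AE_I2) simp
qed

lemma gaussian_space_cos: "X \<in> gaussian_space \<Longrightarrow> expectation (\<lambda>\<omega>. cos (X \<omega>)) = exp (- expectation (\<lambda>\<omega>. (X \<omega>)\<^sup>2) / 2)"
  using gaussian_space_gaussian centered_gaussian_rv(3) by blast

lemma expectation_increments:
  assumes "rectangle a b" "rectangle a' b'"
  shows "expectation (\<lambda>\<omega>. rect_increment (\<lambda>t. W t \<omega>) a b * rect_increment (\<lambda>t. W t \<omega>) a' b')
    = rect_increment (\<lambda>s. rect_increment (\<lambda>t. \<Prod>i\<in>UNIV. min (s $ i) (t $ i)) a' b') a b"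
proof -
  have cov: "expectation (\<lambda>\<omega>. W s \<omega> * W t \<omega>) = (\<Prod>i\<in>UNIV. min (s $ i) (t $ i))"
    if "s \<in> corners a b" "t \<in> corners a' b'" for s t
    using sheet that corners_subset[OF assms(1)] corners_subset[OF assms(2)] unfolding brownian_sheet_def by blast
  have int: "integrable M (\<lambda>\<omega>. (corner_sign a s * W s \<omega>) * (corner_sign a' t * W t \<omega>))"
    if "s \<in> corners a b" "t \<in> corners a' b'" for s t
    using that corners_subset[OF assms(1)] corners_subset[OF assms(2)]
    by (intro gaussian_space_integrable_mult gaussian_space_scale gaussian_space_W) auto
  have "expectation (\<lambda>\<omega>. rect_increment (\<lambda>t. W t \<omega>) a b * rect_increment (\<lambda>t. W t \<omega>) a' b')
    = (\<Sum>s\<in>corners a b. \<Sum>t\<in>corners a' b'. expectation (\<lambda>\<omega>. (corner_sign a s * W s \<omega>) * (corner_sign a' t * W t \<omega>)))"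
    unfolding rect_increment_eq sum_product
    by (rule integral_double_sum) (rule int)
  also have "\<dots> = (\<Sum>s\<in>corners a b. \<Sum>t\<in>corners a' b'. corner_sign a s * (corner_sign a' t * (\<Prod>i\<in>UNIV. min (s $ i) (t $ i))))"
  proof (intro sum.cong refl)
    fix s t assume st: "s \<in> corners a b" "t \<in> corners a' b'"
    have "expectation (\<lambda>\<omega>. (corner_sign a s * W s \<omega>) * (corner_sign a' t * W t \<omega>))
      = expectation (\<lambda>\<omega>. (corner_sign a s * corner_sign a' t) * (W s \<omega> * W t \<omega>))"
      by (simp add: algebra_simps)
    also have "\<dots> = (corner_sign a s * corner_sign a' t) * expectation (\<lambda>\<omega>. W s \<omega> * W t \<omega>)"
      by (rule integral_mult_right_zero)
    finally show "expectation (\<lambda>\<omega>. (corner_sign a s * W s \<omega>) * (corner_sign a' t * W t \<omega>))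
      = corner_sign a s * (corner_sign a' t * (\<Prod>i\<in>UNIV. min (s $ i) (t $ i)))"
      by (simp add: cov[OF st])
  qed
  also have "\<dots> = rect_increment (\<lambda>s. rect_increment (\<lambda>t. \<Prod>i\<in>UNIV. min (s $ i) (t $ i)) a' b') a b"
    by (simp only: rect_increment_eq sum_distrib_left)
  finally show ?thesis .
qed

text \<open>
  An increment over a grid cell has variance \<open>1 / N ^ d\<close>; the factor makes the
  variance \<open>1\<close>.
\<close>

definition normalized_increment :: "nat \<Rightarrow> ('n \<Rightarrow> nat) \<Rightarrow> 'w \<Rightarrow> real"
  where "normalized_increment N k \<omega> = sqrt (real N ^ CARD('n)) * rect_increment (\<lambda>t. W t \<omega>) (lower_corner N k) (upper_corner N k)"

lemma normalized_increment_mem: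
  assumes "k \<in> grid N"
  shows "normalized_increment N k \<in> gaussian_space"
proof -
  have "(\<lambda>\<omega>. rect_increment (\<lambda>t. W t \<omega>) (lower_corner N k) (upper_corner N k)) \<in> gaussian_space"
    unfolding rect_increment_eq
    using rectangle_cell[OF assms] by (intro gaussian_spaceI finite_corners corners_subset)
  from gaussian_space_scale[OF this] show ?thesis
    unfolding normalized_increment_def[abs_def] .
qed

lemma normalized_increment_covariance:
  assumes k: "k \<in> grid N" and l: "l \<in> grid N"
  shows "expectation (\<lambda>\<omega>. normalized_increment N k \<omega> * normalized_increment N l \<omega>) = (if k = l then 1 else 0)"
proof -
  have N: "N > 0" using k by (auto simp: grid_def)
  let ?I = "\<lambda>k \<omega>. rect_increment (\<lambda>t. W t \<omega>) (lower_corner N k) (upper_corner N k)"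
  have "normalized_increment N k \<omega> * normalized_increment N l \<omega> = real N ^ CARD('n) * (?I k \<omega> * ?I l \<omega>)" for \<omega>
  proof -
    have "normalized_increment N k \<omega> * normalized_increment N l \<omega> = (sqrt (real N ^ CARD('n)) * sqrt (real N ^ CARD('n))) * (?I k \<omega> * ?I l \<omega>)"
      by (simp only: normalized_increment_def mult_ac)
    then show ?thesis by simp
  qed
  then have "expectation (\<lambda>\<omega>. normalized_increment N k \<omega> * normalized_increment N l \<omega>) = real N ^ CARD('n) * expectation (\<lambda>\<omega>. ?I k \<omega> * ?I l \<omega>)"
    by simp
  also have "\<dots> = (if k = l then 1 else 0)"
    using N unfolding expectation_increments[OF rectangle_cell[OF k] rectangle_cell[OF l]] sheet_covariance_cells[OF k l]
    by simp
  finally show ?thesis .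
qed

definition mean_cos :: "nat \<Rightarrow> 'w \<Rightarrow> real"
  where "mean_cos N \<omega> = (\<Sum>k\<in>grid N. cos (normalized_increment N k \<omega>)) / real N ^ CARD('n)"

lemma integrable_bounded_function:
  fixes f :: "'w \<Rightarrow> real"
  assumes "f \<in> borel_measurable M" "\<And>\<omega>. \<bar>f \<omega>\<bar> \<le> B"
  shows "integrable M f"
  using assms by (intro integrable_const_bound[where B = B]) auto

text \<open>
  Two normalized increments \<open>X\<close> and \<open>Y\<close> over distinct cells are
  uncorrelated, so \<open>X + Y\<close> and \<open>X - Y\<close> are centered Gaussian of variance
  \<open>2\<close>. By the formula \<open>cos X * cos Y = (cos (X - Y) + cos (X + Y)) / 2\<close>,
  the mean of the product is \<open>exp (- 1)\<close>, the product of the means \<open>exp (- 1 /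
  2)\<close>. One-dimensional Gaussian laws thus give the decorrelation of the cosines. For equal
  cells the bound holds because cosines are at most \<open>1\<close>.
\<close>

lemma cos_increments_uncorrelated:
  assumes k: "k \<in> grid N" and l: "l \<in> grid N"
  shows "integrable M (\<lambda>\<omega>. (cos (normalized_increment N k \<omega>) - exp (- 1 / 2)) * (cos (normalized_increment N l \<omega>) - exp (- 1 / 2)))" (is "integrable M ?f")
    and "expectation (\<lambda>\<omega>. (cos (normalized_increment N k \<omega>) - exp (- 1 / 2)) * (cos (normalized_increment N l \<omega>) - exp (- 1 / 2)))
      \<le> (if k = l then 1 else 0)"
proof -
  let ?X = "normalized_increment N k" and ?Y = "normalized_increment N l" and ?g = "exp (- 1 / 2) :: real"
  have X: "?X \<in> gaussian_space" and Y: "?Y \<in> gaussian_space" using k l by (auto intro: normalized_increment_mem)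
  note [measurable] = gaussian_space_measurable[OF X] gaussian_space_measurable[OF Y]
  have int_cos: "integrable M (\<lambda>\<omega>. cos (?X \<omega>))" "integrable M (\<lambda>\<omega>. cos (?Y \<omega>))"
    by (rule integrable_bounded_function[where B = 1]; simp)+
  have cos_prod: "\<bar>cos x * cos y\<bar> \<le> 1" for x y :: real
    by (simp add: abs_mult mult_le_one)
  have int_prod: "integrable M (\<lambda>\<omega>. cos (?X \<omega>) * cos (?Y \<omega>))"
    using cos_prod by (intro integrable_bounded_function[where B = 1]) simp_all
  have eq: "?f = (\<lambda>\<omega>. cos (?X \<omega>) * cos (?Y \<omega>) - ?g * cos (?X \<omega>) - ?g * cos (?Y \<omega>) + ?g * ?g)"
    by (simp add: algebra_simps fun_eq_iff)
  show "integrable M ?f"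
    unfolding eq using int_cos int_prod by (intro Bochner_Integration.integrable_add Bochner_Integration.integrable_diff integrable_mult_right) auto
  have cosX: "expectation (\<lambda>\<omega>. cos (?X \<omega>)) = ?g" "expectation (\<lambda>\<omega>. cos (?Y \<omega>)) = ?g"
    using gaussian_space_cos[OF X] gaussian_space_cos[OF Y] normalized_increment_covariance[OF k k] normalized_increment_covariance[OF l l]
    by (simp_all add: power2_eq_square)
  have gg: "?g * ?g = exp (- 1)"
    by (simp add: exp_add[symmetric])
  have "expectation ?f = expectation (\<lambda>\<omega>. cos (?X \<omega>) * cos (?Y \<omega>)) - ?g * ?g"
    unfolding eq using int_cos int_prod by (simp add: cosX prob_space)
  also have "\<dots> \<le> (if k = l then 1 else 0)"
  proof (cases "k = l")
    case True
    have "expectation (\<lambda>\<omega>. cos (?X \<omega>) * cos (?Y \<omega>)) \<le> expectation (\<lambda>_. 1)"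
      using int_prod abs_le_D1[OF cos_prod] by (intro integral_mono) simp_all
    then have "expectation (\<lambda>\<omega>. cos (?X \<omega>) * cos (?Y \<omega>)) \<le> 1"
      by (simp add: prob_space)
    moreover have "0 \<le> ?g * ?g"
      by simp
    ultimately show ?thesis
      unfolding if_P[OF True] by linarith
  next
    case False
    have sum: "(\<lambda>\<omega>. ?X \<omega> + ?Y \<omega>) \<in> gaussian_space" and diff: "(\<lambda>\<omega>. ?X \<omega> - ?Y \<omega>) \<in> gaussian_space"
      using gaussian_space_add[OF X Y] gaussian_space_add[OF X gaussian_space_scale[OF Y, of "-1"]] by simp_all
    note [measurable] = gaussian_space_measurable[OF sum] gaussian_space_measurable[OF diff]
    have ints: "integrable M (\<lambda>\<omega>. ?X \<omega> * ?X \<omega>)" "integrable M (\<lambda>\<omega>. ?Y \<omega> * ?Y \<omega>)" "integrable M (\<lambda>\<omega>. ?X \<omega> * ?Y \<omega>)"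
      using X Y by (auto intro: gaussian_space_integrable_mult)
    have covs: "expectation (\<lambda>\<omega>. ?X \<omega> * ?X \<omega>) = 1" "expectation (\<lambda>\<omega>. ?Y \<omega> * ?Y \<omega>) = 1"
        "expectation (\<lambda>\<omega>. ?X \<omega> * ?Y \<omega>) = 0"
      using normalized_increment_covariance k l False by auto
    have "expectation (\<lambda>\<omega>. (?X \<omega> + ?Y \<omega>)\<^sup>2)
        = expectation (\<lambda>\<omega>. ?X \<omega> * ?X \<omega> + ?Y \<omega> * ?Y \<omega> + 2 * (?X \<omega> * ?Y \<omega>))"
      by (simp add: power2_eq_square algebra_simps)
    also have "\<dots> = 2"
      using ints by (simp add: covs)
    finally have s: "expectation (\<lambda>\<omega>. cos (?X \<omega> + ?Y \<omega>)) = exp (- 1)"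
      using gaussian_space_cos[OF sum] by simp
    have "expectation (\<lambda>\<omega>. (?X \<omega> - ?Y \<omega>)\<^sup>2)
        = expectation (\<lambda>\<omega>. ?X \<omega> * ?X \<omega> + ?Y \<omega> * ?Y \<omega> - 2 * (?X \<omega> * ?Y \<omega>))"
      by (simp add: power2_eq_square algebra_simps)
    also have "\<dots> = 2"
      using ints by (simp add: covs)
    finally have d: "expectation (\<lambda>\<omega>. cos (?X \<omega> - ?Y \<omega>)) = exp (- 1)"
      using gaussian_space_cos[OF diff] by simp
    have "integrable M (\<lambda>\<omega>. cos (?X \<omega> - ?Y \<omega>))" "integrable M (\<lambda>\<omega>. cos (?X \<omega> + ?Y \<omega>))"
      by (rule integrable_bounded_function[where B = 1]; simp)+
    then have E: "expectation (\<lambda>\<omega>. cos (?X \<omega>) * cos (?Y \<omega>)) = exp (- 1)"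
      unfolding cos_times_cos by (simp add: s d)
    show ?thesis
      unfolding gg E using False by simp
  qed
  finally show "expectation ?f \<le> (if k = l then 1 else 0)" .
qed

text \<open>
  Expanding the square of the sum, only the diagonal contributes: \<open>N ^ d\<close> terms, each
  at most \<open>1\<close>, are divided by \<open>N ^ (2 * d)\<close>.
\<close>

lemma mean_cos_variance:
  assumes "N > 0"
  shows "integrable M (\<lambda>\<omega>. (mean_cos N \<omega> - exp (- 1 / 2))\<^sup>2)"
    and "expectation (\<lambda>\<omega>. (mean_cos N \<omega> - exp (- 1 / 2))\<^sup>2) \<le> 1 / real N ^ CARD('n)"
proof -
  define n where "n = real N ^ CARD('n)"
  have n: "n > 0" using assms by (simp add: n_def)
  define Z where "Z k \<omega> = cos (normalized_increment N k \<omega>) - exp (- 1 / 2)" for k \<omega>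
  have card: "real (card (grid N :: ('n \<Rightarrow> nat) set)) = n"
    by (simp add: card_grid n_def)
  have "mean_cos N \<omega> - exp (- 1 / 2) = (\<Sum>k\<in>grid N. Z k \<omega>) / n" for \<omega>
    using n by (simp add: mean_cos_def Z_def sum_subtractf card n_def[symmetric] diff_divide_distrib)
  then have eq: "(\<lambda>\<omega>. (mean_cos N \<omega> - exp (- 1 / 2))\<^sup>2) = (\<lambda>\<omega>. (1 / n\<^sup>2) * (\<Sum>k\<in>grid N. \<Sum>l\<in>grid N. Z k \<omega> * Z l \<omega>))"
    by (simp add: power_divide power2_eq_square sum_product)
  have int: "integrable M (\<lambda>\<omega>. Z k \<omega> * Z l \<omega>)" if "k \<in> grid N" "l \<in> grid N" for k l
    unfolding Z_def by (rule cos_increments_uncorrelated(1)[OF that])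
  show "integrable M (\<lambda>\<omega>. (mean_cos N \<omega> - exp (- 1 / 2))\<^sup>2)"
    unfolding eq using int by (intro integrable_mult_right Bochner_Integration.integrable_sum)
  have "expectation (\<lambda>\<omega>. \<Sum>k\<in>grid N. \<Sum>l\<in>grid N. Z k \<omega> * Z l \<omega>)
      = (\<Sum>k\<in>grid N. \<Sum>l\<in>grid N. expectation (\<lambda>\<omega>. Z k \<omega> * Z l \<omega>))"
    by (rule integral_double_sum) (rule int)
  also have "\<dots> \<le> (\<Sum>k\<in>(grid N :: ('n \<Rightarrow> nat) set). \<Sum>l\<in>grid N. if k = l then 1 else 0)"
  proof (rule sum_mono, rule sum_mono)
    fix k l :: "'n \<Rightarrow> nat" assume "k \<in> grid N" "l \<in> grid N"
    then show "expectation (\<lambda>\<omega>. Z k \<omega> * Z l \<omega>) \<le> (if k = l then 1 else 0)"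
      unfolding Z_def by (rule cos_increments_uncorrelated(2))
  qed
  also have "\<dots> = n"
    by (simp add: card)
  finally have "expectation (\<lambda>\<omega>. (mean_cos N \<omega> - exp (- 1 / 2))\<^sup>2) \<le> (1 / n\<^sup>2) * n"
    unfolding eq by (simp add: divide_right_mono)
  then show "expectation (\<lambda>\<omega>. (mean_cos N \<omega> - exp (- 1 / 2))\<^sup>2) \<le> 1 / real N ^ CARD('n)"
    using n by (simp add: n_def[symmetric] power2_eq_square)
qed

text \<open>
  Fatou's lemma, applied to the variance bound \<open>1 / N ^ d\<close>.
\<close>

lemma AE_liminf_mean_cos:
  "AE \<omega> in M. liminf (\<lambda>N. ennreal ((mean_cos N \<omega> - exp (- 1 / 2))\<^sup>2)) = 0"
proof -
  have [measurable]: "mean_cos N \<in> borel_measurable M" for N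
    unfolding mean_cos_def using gaussian_space_measurable[OF normalized_increment_mem]
    by (intro borel_measurable_divide borel_measurable_sum borel_measurable_const) auto
  have "(\<integral>\<^sup>+\<omega>. liminf (\<lambda>N. ennreal ((mean_cos N \<omega> - exp (- 1 / 2))\<^sup>2)) \<partial>M)
      \<le> liminf (\<lambda>N. \<integral>\<^sup>+\<omega>. ennreal ((mean_cos N \<omega> - exp (- 1 / 2))\<^sup>2) \<partial>M)"
    by (rule nn_integral_liminf) measurable
  also have "\<dots> \<le> liminf (\<lambda>N. ennreal (1 / real N ^ CARD('n)))"
  proof (rule Liminf_mono)
    show "\<forall>\<^sub>F N in sequentially. (\<integral>\<^sup>+\<omega>. ennreal ((mean_cos N \<omega> - exp (- 1 / 2))\<^sup>2) \<partial>M) \<le> ennreal (1 / real N ^ CARD('n))"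
      using eventually_gt_at_top[of 0]
    proof eventually_elim
      case (elim N)
      then show ?case
        using mean_cos_variance[OF elim] by (subst nn_integral_eq_integral) (auto intro: ennreal_leI)
    qed
  qed
  also have "\<dots> = 0"
  proof -
    have "(\<lambda>N. 1 / real N ^ CARD('n)) \<longlonglongrightarrow> 0"
      by (intro tendsto_divide_0[OF tendsto_const] filterlim_at_top_imp_at_infinity
          filterlim_pow_at_top filterlim_real_sequentially) simp
    then have "(\<lambda>N. ennreal (1 / real N ^ CARD('n))) \<longlonglongrightarrow> ennreal 0"
      by (rule tendsto_ennrealI)
    then show ?thesis
      using lim_imp_Liminf[OF sequentially_bot] by fastforce
  qed
  finally have "(\<integral>\<^sup>+\<omega>. liminf (\<lambda>N. ennreal ((mean_cos N \<omega> - exp (- 1 / 2))\<^sup>2)) \<partial>M) = 0"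
    by simp
  then show ?thesis
    by (subst (asm) nn_integral_0_iff_AE) measurable
qed

text \<open>
  If the scaled variation tended to \<open>0\<close>, then so would \<open>1 - mean_cos N
  \<omega>\<close>, which lies between \<open>0\<close> and that variation: normalization
  multiplies the increments by the square root of \<open>N ^ d\<close>, the mean divides by
  \<open>N ^ d\<close>, and \<open>N \<le> sqrt (N ^ d)\<close> because \<open>d \<ge> 2\<close>.
  Then \<open>mean_cos N \<omega>\<close> would tend to \<open>1\<close> and stay away from
  \<open>exp (- 1 / 2)\<close>.
\<close>

lemma grid_variation_not_small:
  assumes d: "CARD('n) \<ge> 2"
    and lim0: "liminf (\<lambda>N. ennreal ((mean_cos N \<omega> - exp (- 1 / 2))\<^sup>2)) = 0"
  shows "\<not> (\<lambda>N. (\<Sum>k\<in>grid N. \<bar>rect_increment (\<lambda>t. W t \<omega>) (lower_corner N k) (upper_corner N k)\<bar>) / real N) \<longlonglongrightarrow> 0"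
    (is "\<not> ?V \<longlonglongrightarrow> 0")
proof
  assume V: "?V \<longlonglongrightarrow> 0"
  let ?I = "\<lambda>N k. rect_increment (\<lambda>t. W t \<omega>) (lower_corner N k) (upper_corner N k)"
  have bounds: "0 \<le> 1 - mean_cos N \<omega> \<and> 1 - mean_cos N \<omega> \<le> ?V N" if N: "N > 0" for N
  proof -
    define n where "n = real N ^ CARD('n)"
    have n: "n > 0" using N by (simp add: n_def)
    have card: "real (card (grid N :: ('n \<Rightarrow> nat) set)) = n"
      by (simp add: card_grid n_def)
    have eq: "1 - mean_cos N \<omega> = (\<Sum>k\<in>grid N. 1 - cos (normalized_increment N k \<omega>)) / n"
      using n by (simp add: mean_cos_def sum_subtractf card n_def[symmetric] diff_divide_distrib)
    have "real N \<le> sqrt n"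
    proof (rule real_le_rsqrt)
      show "(real N)\<^sup>2 \<le> n"
        unfolding n_def using N d by (intro power_increasing) auto
    qed
    have "(\<Sum>k\<in>grid N. 1 - cos (normalized_increment N k \<omega>)) \<le> (\<Sum>k\<in>grid N. \<bar>normalized_increment N k \<omega>\<bar>)"
      by (intro sum_mono one_minus_cos_le)
    also have "\<dots> = sqrt n * (\<Sum>k\<in>grid N. \<bar>?I N k\<bar>)"
      using n by (simp add: normalized_increment_def n_def[symmetric] abs_mult sum_distrib_left)
    finally have "1 - mean_cos N \<omega> \<le> sqrt n * (\<Sum>k\<in>grid N. \<bar>?I N k\<bar>) / n"
      unfolding eq using n by (intro divide_right_mono) auto
    also have "\<dots> = (\<Sum>k\<in>grid N. \<bar>?I N k\<bar>) / sqrt n"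
      using n by (simp add: field_simps)
    also have "\<dots> \<le> ?V N"
      using \<open>real N \<le> sqrt n\<close> N by (intro divide_left_mono sum_nonneg) (auto simp: n)
    finally have "1 - mean_cos N \<omega> \<le> ?V N" .
    moreover have "0 \<le> 1 - mean_cos N \<omega>"
      unfolding eq using n by (intro divide_nonneg_nonneg sum_nonneg) auto
    ultimately show ?thesis by simp
  qed
  have "(\<lambda>N. 1 - mean_cos N \<omega>) \<longlonglongrightarrow> 0"
  proof (rule tendsto_sandwich[OF _ _ tendsto_const V])
    show "\<forall>\<^sub>F N in sequentially. 0 \<le> 1 - mean_cos N \<omega>" "\<forall>\<^sub>F N in sequentially. 1 - mean_cos N \<omega> \<le> ?V N"
      using eventually_gt_at_top[of "0 :: nat"] by (eventually_elim, use bounds in blast)+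
  qed
  then have "(\<lambda>N. (1 - (1 - mean_cos N \<omega>) - exp (- 1 / 2))\<^sup>2) \<longlonglongrightarrow> (1 - 0 - exp (- 1 / 2))\<^sup>2"
    by (intro tendsto_intros)
  then have "(\<lambda>N. ennreal ((mean_cos N \<omega> - exp (- 1 / 2))\<^sup>2)) \<longlonglongrightarrow> ennreal ((1 - exp (- 1 / 2))\<^sup>2)"
    by (intro tendsto_ennrealI) simp
  then have "liminf (\<lambda>N. ennreal ((mean_cos N \<omega> - exp (- 1 / 2))\<^sup>2)) = ennreal ((1 - exp (- 1 / 2))\<^sup>2)"
    by (intro lim_imp_Liminf) auto
  with lim0 show False
    by simp
qed

end

theorem theorem7p2:
  fixes M :: "'w measure" and W :: "real ^ 'n \<Rightarrow> 'w \<Rightarrow> real"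
  assumes "CARD('n) \<ge> 2"
    and "prob_space M"
    and "brownian_sheet M W"
    and "\<And>\<omega>. \<omega> \<in> space M \<Longrightarrow> (\<lambda>t. W t \<omega>) \<in> C0_cube"
  shows "AE \<omega> in M. \<not> strongly_chargeable (\<lambda>t. W t \<omega>)"
proof -
  interpret brownian_sheet_space M W
    using assms(2,3) by (simp add: brownian_sheet_space_def brownian_sheet_space_axioms_def)
  show ?thesis
    using AE_liminf_mean_cos
  proof eventually_elim
    case (elim \<omega>)
    from grid_variation_not_small[OF assms(1) this] show ?case
      using strongly_chargeable_imp_grid_variation_small by blast
  qed
qed

end
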